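(* Let $\kappa>0$, $s\in[2,\tfrac52)$, and let $(u_0,\rho_0)\in H^s(0,\tfrac12)\times H^{s-1}(0,\tfrac12)$ with $u_0(0)=u_0(\tfrac12)=0$ and $\rho_0(0)=\rho_0(\tfrac12)=0$. Let $(u,\rho)$ be the solution of (IBVP-2HS) on its maximal interval $[0,T)$. Then $(u,\rho)$ does not blow up in $H^1(0,\tfrac12)\times L_2(0,\tfrac12)$ in finite time: for every finite $T'>0$, $$\sup_{t\in[0,T)\cap[0,T']}\Big(\|u(t)\|_{H^1(0,\frac12)}+\|\rho(t)\|_{L_2(0,\frac12)}\Big)<\infty.$$
   Context: $H^s(a,b)$ is the $L_2$-Sobolev space of order $s$ on $(a,b)$. For $\kappa>0$, the initial boundary value problem (IBVP-2HS) on $(0,\tfrac12)$ is $$m_t=-m_xu-2u_xm-\kappa\rho\rho_x,\quad m=-u_{xx},\quad \rho_t=-(\rho u)_x\qquad (t>0,\ x\in(0,\tfrac12)),$$ with $u(0,\cdot)=u_0$, $\rho(0,\cdot)=\rho_0$ on $[0,\tfrac12]$ and $u(t,0)=\rho(t,0)=u(t,\tfrac12)=\rho(t,\tfrac12)=0$ for all $t\ge0$. For such data with $s\in[2,\tfrac52)$ it has a unique solution on a maximal interval $[0,T)$ in $C([0,T);H^s\times H^{s-1})\cap C^1([0,T);H^{s-1}\times H^{s-2})$ over $(0,\tfrac12)$. *)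

theory Defs
  imports "HOL-Analysis.Analysis"
begin

definition Ival :: "real set" where
  "Ival = {0<..<1/2}"

definition L2_mem :: "(real \<Rightarrow> real) \<Rightarrow> bool" where
  "L2_mem f \<longleftrightarrow> set_borel_measurable lborel Ival f \<and>
                 set_integrable lborel Ival (\<lambda>x. (f x)^2)"

definition L2_norm :: "(real \<Rightarrow> real) \<Rightarrow> real" where
  "L2_norm f = sqrt (LINT x:Ival|lborel. (f x)^2)"

definition test_fun :: "(real \<Rightarrow> real) \<Rightarrow> bool" where
  "test_fun \<phi> \<longleftrightarrow> (\<forall>k x. (deriv ^^ k) \<phi> differentiable (at x)) \<and>
     (\<exists>a b. 0 < a \<and> a \<le> b \<and> b < 1/2 \<and> (\<forall>x. x \<notin> {a..b} \<longrightarrow> \<phi> x = 0))"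

definition weak_deriv :: "(real \<Rightarrow> real) \<Rightarrow> (real \<Rightarrow> real) \<Rightarrow> bool" where
  "weak_deriv f g \<longleftrightarrow> (\<forall>\<phi>. test_fun \<phi> \<longrightarrow>
     (LINT x:Ival|lborel. f x * deriv \<phi> x) = - (LINT x:Ival|lborel. g x * \<phi> x))"

definition gag_sq :: "real \<Rightarrow> (real \<Rightarrow> real) \<Rightarrow> ennreal" where
  "gag_sq \<sigma> f = (\<integral>\<^sup>+ p. indicator (Ival \<times> Ival) p *
      ennreal (\<bar>f (fst p) - f (snd p)\<bar>^2 / \<bar>fst p - snd p\<bar> powr (1 + 2*\<sigma>))
      \<partial>(lborel \<Otimes>\<^sub>M lborel))"

definition sob_chain :: "real \<Rightarrow> (real \<Rightarrow> real) \<Rightarrow> (nat \<Rightarrow> real \<Rightarrow> real) \<Rightarrow> bool" where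
  "sob_chain r f g \<longleftrightarrow>
     (\<forall>x\<in>Ival. g 0 x = f x) \<and>
     (\<forall>j\<le>nat \<lfloor>r\<rfloor>. L2_mem (g j)) \<and>
     (\<forall>j<nat \<lfloor>r\<rfloor>. weak_deriv (g j) (g (Suc j))) \<and>
     (frac r \<noteq> 0 \<longrightarrow> gag_sq (frac r) (g (nat \<lfloor>r\<rfloor>)) < \<infinity>)"

definition H_mem :: "real \<Rightarrow> (real \<Rightarrow> real) \<Rightarrow> bool" where
  "H_mem r f \<longleftrightarrow> 0 \<le> r \<and> (\<exists>g. sob_chain r f g)"

definition H_norm :: "real \<Rightarrow> (real \<Rightarrow> real) \<Rightarrow> real" where
  "H_norm r f = (let g = (SOME g. sob_chain r f g) in
     sqrt ((\<Sum>j\<le>nat \<lfloor>r\<rfloor>. (L2_norm (g j))^2) +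
           (if frac r = 0 then 0 else enn2real (gag_sq (frac r) (g (nat \<lfloor>r\<rfloor>))))))"

definition tint :: "ereal \<Rightarrow> real set" where
  "tint T = {t. 0 \<le> t \<and> ereal t < T}"

text \<open>The PDE at time t in weak (distributional) form on (0,1/2):
  m_t = -m_x u - 2 u_x m - kappa rho rho_x with m = -u_xx, paired with a test function,
  and rho_t = -(rho u)_x.  ut, rt are the time derivatives.\<close>
definition pde_at :: "real \<Rightarrow> (real \<Rightarrow> real) \<Rightarrow> (real \<Rightarrow> real) \<Rightarrow> (real \<Rightarrow> real) \<Rightarrow> (real \<Rightarrow> real) \<Rightarrow> bool" where
  "pde_at \<kappa> u \<rho> ut rt \<longleftrightarrow>
     (\<exists>ux uxx. L2_mem ux \<and> L2_mem uxx \<and> weak_deriv u ux \<and> weak_deriv ux uxx \<and>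
       (\<forall>\<phi>. test_fun \<phi> \<longrightarrow>
          - (LINT x:Ival|lborel. ut x * deriv (deriv \<phi>) x)
            = - (LINT x:Ival|lborel. u x * uxx x * deriv \<phi> x)
              + (LINT x:Ival|lborel. ux x * uxx x * \<phi> x)
              + \<kappa> / 2 * (LINT x:Ival|lborel. (\<rho> x)^2 * deriv \<phi> x)
          \<and> (LINT x:Ival|lborel. rt x * \<phi> x) = (LINT x:Ival|lborel. \<rho> x * u x * deriv \<phi> x)))"

text \<open>(u, rho) solves IBVP-2HS on [0,T) in the class
  C([0,T); H^s x H^(s-1)) \<inter> C^1([0,T); H^(s-1) x H^(s-2)).\<close>
definition is_sol :: "real \<Rightarrow> real \<Rightarrow> (real \<Rightarrow> real) \<Rightarrow> (real \<Rightarrow> real) \<Rightarrow> ereal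
    \<Rightarrow> (real \<Rightarrow> real \<Rightarrow> real) \<Rightarrow> (real \<Rightarrow> real \<Rightarrow> real) \<Rightarrow> bool" where
  "is_sol \<kappa> s u0 \<rho>0 T u \<rho> \<longleftrightarrow>
     0 < T \<and>
     (\<forall>x\<in>{0..1/2}. u 0 x = u0 x \<and> \<rho> 0 x = \<rho>0 x) \<and>
     (\<forall>t\<in>tint T. continuous_on {0..1/2} (u t) \<and> continuous_on {0..1/2} (\<rho> t) \<and>
        u t 0 = 0 \<and> u t (1/2) = 0 \<and> \<rho> t 0 = 0 \<and> \<rho> t (1/2) = 0 \<and>
        H_mem s (u t) \<and> H_mem (s - 1) (\<rho> t) \<and>
        ((\<lambda>\<tau>. H_norm s (\<lambda>x. u \<tau> x - u t x)) \<longlongrightarrow> 0) (at t within tint T) \<and>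
        ((\<lambda>\<tau>. H_norm (s - 1) (\<lambda>x. \<rho> \<tau> x - \<rho> t x)) \<longlongrightarrow> 0) (at t within tint T)) \<and>
     (\<exists>ut rt. \<forall>t\<in>tint T.
        H_mem (s - 1) (ut t) \<and> H_mem (s - 2) (rt t) \<and>
        ((\<lambda>\<tau>. H_norm (s - 1) (\<lambda>x. (u \<tau> x - u t x) / (\<tau> - t) - ut t x)) \<longlongrightarrow> 0) (at t within tint T) \<and>
        ((\<lambda>\<tau>. H_norm (s - 2) (\<lambda>x. (\<rho> \<tau> x - \<rho> t x) / (\<tau> - t) - rt t x)) \<longlongrightarrow> 0) (at t within tint T) \<and>
        ((\<lambda>\<tau>. H_norm (s - 1) (\<lambda>x. ut \<tau> x - ut t x)) \<longlongrightarrow> 0) (at t within tint T) \<and>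
        ((\<lambda>\<tau>. H_norm (s - 2) (\<lambda>x. rt \<tau> x - rt t x)) \<longlongrightarrow> 0) (at t within tint T) \<and>
        pde_at \<kappa> (u t) (\<rho> t) (ut t) (rt t))"

definition is_max_sol :: "real \<Rightarrow> real \<Rightarrow> (real \<Rightarrow> real) \<Rightarrow> (real \<Rightarrow> real) \<Rightarrow> ereal
    \<Rightarrow> (real \<Rightarrow> real \<Rightarrow> real) \<Rightarrow> (real \<Rightarrow> real \<Rightarrow> real) \<Rightarrow> bool" where
  "is_max_sol \<kappa> s u0 \<rho>0 T u \<rho> \<longleftrightarrow> is_sol \<kappa> s u0 \<rho>0 T u \<rho> \<and>
     \<not> (\<exists>T2 u2 \<rho>2. T < T2 \<and> is_sol \<kappa> s u0 \<rho>0 T2 u2 \<rho>2 \<and>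
          (\<forall>t\<in>tint T. \<forall>x\<in>{0..1/2}. u2 t x = u t x \<and> \<rho>2 t x = \<rho> t x))"

end

theory Submission
  imports Defs
begin

text \<open>
  The energy \<open>E = \<parallel>u\<^sub>x\<parallel>\<^sup>2 + \<kappa> \<parallel>\<rho>\<parallel>\<^sup>2\<close> in \<open>L\<^sub>2\<close> is conserved. Testing the momentum equation with \<open>u\<close>
  gives \<open>\<integral> u\<^sub>t\<^sub>x u\<^sub>x = \<kappa>/2 \<integral> \<rho>\<^sup>2 u\<^sub>x\<close>, and testing the continuity equation with \<open>\<rho>\<close> gives
  \<open>\<integral> \<rho>\<^sub>t \<rho> = -1/2 \<integral> \<rho>\<^sup>2 u\<^sub>x\<close>, so that the two contributions to the time derivative of \<open>E\<close> cancel. The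
  equations hold only against smooth compactly supported test functions, but an integrable function
  with an integrable weak derivative is a primitive almost everywhere (du Bois-Reymond), so Fubini's
  theorem allows testing with every continuous function that has an integrable weak derivative and
  vanishes at the end points, such as \<open>u\<close> and \<open>\<rho>\<close>. Finally, \<open>u\<close> vanishes at 0, so \<open>\<bar>u\<bar> \<le> \<parallel>u\<^sub>x\<parallel>\<close>, and
  \<open>E\<close> controls the norm of \<open>(u, \<rho>)\<close> in \<open>H\<^sup>1 \<times> L\<^sub>2\<close>.
\<close>

section \<open>Square-integrable functions\<close>

definition square_integrable :: "'a measure \<Rightarrow> ('a \<Rightarrow> real) \<Rightarrow> bool" where
  "square_integrable M f \<longleftrightarrow> f \<in> borel_measurable M \<and> integrable M (\<lambda>x. (f x)^2)"

definition norm_L2 :: "'a measure \<Rightarrow> ('a \<Rightarrow> real) \<Rightarrow> real" where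
  "norm_L2 M f = sqrt (\<integral>x. (f x)^2 \<partial>M)"

lemma square_integrable_measurable:
  "square_integrable M f \<Longrightarrow> f \<in> borel_measurable M"
  by (simp add: square_integrable_def)

lemma square_integrable_power2: "square_integrable M f \<Longrightarrow> integrable M (\<lambda>x. (f x)^2)"
  by (simp add: square_integrable_def)

lemma norm_L2_nonneg [simp]: "0 \<le> norm_L2 M f"
  by (simp add: norm_L2_def)

lemma norm_L2_power2: "(norm_L2 M f)^2 = (\<integral>x. (f x)^2 \<partial>M)"
  by (simp add: norm_L2_def)

lemma norm_L2_cong: "(\<And>x. x \<in> space M \<Longrightarrow> f x = g x) \<Longrightarrow> norm_L2 M f = norm_L2 M g"
  unfolding norm_L2_def by (intro arg_cong[where f = sqrt] Bochner_Integration.integral_cong) auto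

lemma norm_L2_cong_AE:
  assumes "AE x in M. f x = g x" "f \<in> borel_measurable M" "g \<in> borel_measurable M"
  shows "norm_L2 M f = norm_L2 M g"
  unfolding norm_L2_def using assms by (intro arg_cong[where f = sqrt] integral_cong_AE) auto

lemma square_integrable_integrable_mult:
  assumes "square_integrable M f" "square_integrable M g"
  shows "integrable M (\<lambda>x. f x * g x)"
proof (rule Bochner_Integration.integrable_bound)
  show "integrable M (\<lambda>x. (f x)^2 + (g x)^2)"
    using assms by (simp add: square_integrable_def)
  show "(\<lambda>x. f x * g x) \<in> borel_measurable M"
    using assms by (intro borel_measurable_times square_integrable_measurable)
  have "\<bar>a * b\<bar> \<le> a^2 + b^2" for a b :: real
    using sum_squares_bound[of "\<bar>a\<bar>" "\<bar>b\<bar>"] mult_nonneg_nonneg[of "\<bar>a\<bar>" "\<bar>b\<bar>"]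
    unfolding abs_mult power2_abs by linarith
  then show "AE x in M. norm (f x * g x) \<le> norm ((f x)^2 + (g x)^2)"
    by simp
qed

lemma square_integrable_add:
  assumes "square_integrable M f" "square_integrable M g"
  shows "square_integrable M (\<lambda>x. f x + g x)"
  using assms square_integrable_integrable_mult[OF assms]
  by (auto simp: square_integrable_def power2_sum mult.assoc)

lemma square_integrable_cmult:
  "square_integrable M f \<Longrightarrow> square_integrable M (\<lambda>x. c * f x)"
  by (auto simp: square_integrable_def power_mult_distrib)

lemma square_integrable_diff:
  assumes "square_integrable M f" "square_integrable M g"
  shows "square_integrable M (\<lambda>x. f x - g x)"
  using square_integrable_add[OF assms(1) square_integrable_cmult[OF assms(2), of "-1"]] by simp

lemma square_integrable_difference_quotient:
  assumes "square_integrable M f" "square_integrable M g" "square_integrable M k"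
  shows "square_integrable M (\<lambda>x. (f x - g x) / h - k x)"
proof -
  have "square_integrable M (\<lambda>x. (1 / h) * (f x - g x) - k x)"
    by (intro square_integrable_diff square_integrable_cmult assms)
  then show ?thesis by simp
qed

lemma Cauchy_Schwarz_L2:
  assumes "square_integrable M f" "square_integrable M g"
  shows "\<bar>\<integral>x. f x * g x \<partial>M\<bar> \<le> norm_L2 M f * norm_L2 M g"
proof -
  note [measurable] = assms[THEN square_integrable_measurable]
  have int: "integrable M (\<lambda>x. \<bar>f x\<bar> * \<bar>g x\<bar>)"
    using square_integrable_integrable_mult[OF assms] by (simp flip: abs_mult)
  have nn_norm: "(\<integral>\<^sup>+x. ennreal \<bar>f x\<bar> ^ 2 \<partial>M) = ennreal ((norm_L2 M f)^2)"
    if "square_integrable M f" for f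
    using that
    by (simp add: ennreal_power norm_L2_power2 square_integrable_def nn_integral_eq_integral)
  have "ennreal ((\<integral>x. \<bar>f x\<bar> * \<bar>g x\<bar> \<partial>M)^2) = (\<integral>\<^sup>+x. ennreal \<bar>f x\<bar> * ennreal \<bar>g x\<bar> \<partial>M)^2"
    using nn_integral_eq_integral[OF int] by (simp add: ennreal_mult ennreal_power)
  also have "\<dots> \<le> (\<integral>\<^sup>+x. ennreal \<bar>f x\<bar> ^ 2 \<partial>M) * (\<integral>\<^sup>+x. ennreal \<bar>g x\<bar> ^ 2 \<partial>M)"
    by (rule Cauchy_Schwarz_nn_integral) measurable
  also have "\<dots> = ennreal ((norm_L2 M f * norm_L2 M g)^2)"
    using assms by (simp add: nn_norm ennreal_mult power_mult_distrib)
  finally have "(\<integral>x. \<bar>f x\<bar> * \<bar>g x\<bar> \<partial>M)^2 \<le> (norm_L2 M f * norm_L2 M g)^2"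
    by simp
  then have "(\<integral>x. \<bar>f x\<bar> * \<bar>g x\<bar> \<partial>M) \<le> norm_L2 M f * norm_L2 M g"
    by (rule power2_le_imp_le) simp
  moreover have "\<bar>\<integral>x. f x * g x \<partial>M\<bar> \<le> (\<integral>x. \<bar>f x\<bar> * \<bar>g x\<bar> \<partial>M)"
    using integral_abs_bound[of M "\<lambda>x. f x * g x"] by (simp add: abs_mult)
  ultimately show ?thesis by linarith
qed

lemma norm_L2_triangle:
  assumes "square_integrable M f" "square_integrable M g"
  shows "norm_L2 M (\<lambda>x. f x + g x) \<le> norm_L2 M f + norm_L2 M g"
proof (rule power2_le_imp_le)
  have "(norm_L2 M (\<lambda>x. f x + g x))^2 = (norm_L2 M f)^2 + (norm_L2 M g)^2 + 2 * (\<integral>x. f x * g x \<partial>M)"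
    using assms square_integrable_integrable_mult[OF assms]
    by (simp add: norm_L2_power2 power2_sum mult.assoc square_integrable_def)
  also have "\<dots> \<le> (norm_L2 M f + norm_L2 M g)^2"
    using Cauchy_Schwarz_L2[OF assms] by (simp add: power2_sum)
  finally show "(norm_L2 M (\<lambda>x. f x + g x))^2 \<le> (norm_L2 M f + norm_L2 M g)^2" .
qed simp

lemma norm_L2_cmult: "norm_L2 M (\<lambda>x. c * f x) = \<bar>c\<bar> * norm_L2 M f"
  by (simp add: norm_L2_def power_mult_distrib real_sqrt_mult)

lemma (in finite_measure) square_integrable_integrable:
  "square_integrable M f \<Longrightarrow> integrable M f"
  by (auto simp: square_integrable_def intro: square_integrable_imp_integrable)

lemma (in finite_measure) square_integrable_if_bounded:
  assumes "f \<in> borel_measurable M" "\<And>x. x \<in> space M \<Longrightarrow> \<bar>f x\<bar> \<le> B"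
  shows "square_integrable M f"
  unfolding square_integrable_def
proof
  show "integrable M (\<lambda>x. (f x)^2)"
  proof (rule integrable_const_bound)
    show "AE x in M. norm ((f x)^2) \<le> B^2"
      using power_mono[OF assms(2), of _ 2] by auto
  qed (use assms(1) in measurable)
qed fact

lemma (in finite_measure) norm_L2_le_if_bounded:
  assumes "f \<in> borel_measurable M" "\<And>x. x \<in> space M \<Longrightarrow> \<bar>f x\<bar> \<le> B" "0 \<le> B"
  shows "norm_L2 M f \<le> B * sqrt (measure M (space M))"
proof -
  have "(\<integral>x. (f x)^2 \<partial>M) \<le> (\<integral>x. B^2 \<partial>M)"
    using square_integrable_if_bounded[OF assms(1,2)] power_mono[OF assms(2), of _ 2]
    by (intro integral_mono) (auto simp: square_integrable_def)
  then have "norm_L2 M f \<le> sqrt (B^2 * measure M (space M))"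
    by (simp add: norm_L2_def mult.commute)
  then show ?thesis
    using assms(3) by (simp add: real_sqrt_mult)
qed

lemma tendsto_integral_mult_L2:
  assumes "\<forall>\<^sub>F t in F. square_integrable M (f t)" "\<forall>\<^sub>F t in F. square_integrable M (g t)"
    and "square_integrable M f0" "square_integrable M g0"
    and "((\<lambda>t. norm_L2 M (\<lambda>x. f t x - f0 x)) \<longlongrightarrow> 0) F" "((\<lambda>t. norm_L2 M (\<lambda>x. g t x - g0 x)) \<longlongrightarrow> 0) F"
  shows "((\<lambda>t. \<integral>x. f t x * g t x \<partial>M) \<longlongrightarrow> (\<integral>x. f0 x * g0 x \<partial>M)) F"
proof -
  let ?df = "\<lambda>t x. f t x - f0 x" and ?dg = "\<lambda>t x. g t x - g0 x"
  have "\<forall>\<^sub>F t in F. norm ((\<integral>x. f t x * g t x \<partial>M) - (\<integral>x. f0 x * g0 x \<partial>M))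
      \<le> norm_L2 M (?df t) * norm_L2 M (?dg t) + norm_L2 M (?df t) * norm_L2 M g0
        + norm_L2 M f0 * norm_L2 M (?dg t)"
    using assms(1,2)
  proof eventually_elim
    case (elim t)
    note df = square_integrable_diff[OF elim(1) assms(3)]
    note dg = square_integrable_diff[OF elim(2) assms(4)]
    have "(\<integral>x. f t x * g t x \<partial>M) - (\<integral>x. f0 x * g0 x \<partial>M) =
        (\<integral>x. f t x * g t x - f0 x * g0 x \<partial>M)"
      using elim assms(3,4) by (simp add: square_integrable_integrable_mult)
    also have "\<dots> = (\<integral>x. ?df t x * ?dg t x + ?df t x * g0 x + f0 x * ?dg t x \<partial>M)"
      by (rule Bochner_Integration.integral_cong) (simp_all add: algebra_simps)
    also have "\<dots> = (\<integral>x. ?df t x * ?dg t x \<partial>M) + (\<integral>x. ?df t x * g0 x \<partial>M) + (\<integral>x. f0 x * ?dg t x \<partial>M)"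
      using df dg assms(3,4)
      by (simp only: Bochner_Integration.integral_add Bochner_Integration.integrable_add
          square_integrable_integrable_mult)
    finally show ?case
      using Cauchy_Schwarz_L2[OF df dg] Cauchy_Schwarz_L2[OF df assms(4)]
        Cauchy_Schwarz_L2[OF assms(3) dg]
      by simp
  qed
  moreover have "((\<lambda>t. norm_L2 M (?df t) * norm_L2 M (?dg t) + norm_L2 M (?df t) * norm_L2 M g0
      + norm_L2 M f0 * norm_L2 M (?dg t)) \<longlongrightarrow> 0 * 0 + 0 * norm_L2 M g0 + norm_L2 M f0 * 0) F"
    by (intro tendsto_intros assms(5,6))
  ultimately have "((\<lambda>t. (\<integral>x. f t x * g t x \<partial>M) - (\<integral>x. f0 x * g0 x \<partial>M)) \<longlongrightarrow> 0) F"
    by (simp add: Lim_null_comparison)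
  then show ?thesis
    by (rule LIM_zero_cancel)
qed

lemma tendsto_norm_L2_diff_if_difference_quotient:
  assumes a: "\<And>\<tau>. \<tau> \<in> S \<Longrightarrow> square_integrable M (a \<tau>)" and b: "square_integrable M b" and t: "t \<in> S"
    and lim: "((\<lambda>\<tau>. norm_L2 M (\<lambda>x. (a \<tau> x - a t x) / (\<tau> - t) - b x)) \<longlongrightarrow> 0) (at t within S)"
  shows "((\<lambda>\<tau>. norm_L2 M (\<lambda>x. a \<tau> x - a t x)) \<longlongrightarrow> 0) (at t within S)"
proof (rule Lim_null_comparison)
  let ?r = "\<lambda>\<tau> x. (a \<tau> x - a t x) / (\<tau> - t) - b x"
  have "\<forall>\<^sub>F \<tau> in at t within S. \<tau> \<in> S \<and> \<tau> \<noteq> t"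
    by (simp add: eventually_at_filter)
  then show "\<forall>\<^sub>F \<tau> in at t within S. norm (norm_L2 M (\<lambda>x. a \<tau> x - a t x))
      \<le> \<bar>\<tau> - t\<bar> * (norm_L2 M (?r \<tau>) + norm_L2 M b)"
  proof eventually_elim
    case (elim \<tau>)
    have "norm_L2 M (\<lambda>x. a \<tau> x - a t x) = norm_L2 M (\<lambda>x. (\<tau> - t) * (?r \<tau> x + b x))"
      using elim by simp
    also have "\<dots> = \<bar>\<tau> - t\<bar> * norm_L2 M (\<lambda>x. ?r \<tau> x + b x)"
      by (rule norm_L2_cmult)
    also have "\<dots> \<le> \<bar>\<tau> - t\<bar> * (norm_L2 M (?r \<tau>) + norm_L2 M b)"
      using elim a b t
      by (intro mult_left_mono norm_L2_triangle square_integrable_difference_quotient) auto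
    finally show ?case by simp
  qed
  have "((\<lambda>\<tau>. \<bar>\<tau> - t\<bar> * (norm_L2 M (?r \<tau>) + norm_L2 M b))
      \<longlongrightarrow> \<bar>t - t\<bar> * (0 + norm_L2 M b)) (at t within S)"
    by (intro tendsto_intros lim)
  then show "((\<lambda>\<tau>. \<bar>\<tau> - t\<bar> * (norm_L2 M (?r \<tau>) + norm_L2 M b)) \<longlongrightarrow> 0) (at t within S)"
    by simp
qed

lemma has_real_derivative_norm_L2_power2:
  assumes a: "\<And>\<tau>. \<tau> \<in> S \<Longrightarrow> square_integrable M (a \<tau>)" and b: "square_integrable M b" and t: "t \<in> S"
    and lim: "((\<lambda>\<tau>. norm_L2 M (\<lambda>x. (a \<tau> x - a t x) / (\<tau> - t) - b x)) \<longlongrightarrow> 0) (at t within S)"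
  shows "((\<lambda>\<tau>. (norm_L2 M (a \<tau>))^2) has_real_derivative 2 * (\<integral>x. a t x * b x \<partial>M)) (at t within S)"
proof -
  let ?q = "\<lambda>\<tau> x. (a \<tau> x - a t x) / (\<tau> - t)"
  have S: "\<forall>\<^sub>F \<tau> in at t within S. \<tau> \<in> S"
    by (simp add: eventually_at_filter)
  have q: "square_integrable M (?q \<tau>)" if "\<tau> \<in> S" for \<tau>
    using square_integrable_cmult[OF square_integrable_diff[OF a[OF that] a[OF t]],
        of "1 / (\<tau> - t)"]
    by simp
  have sum_lim: "((\<lambda>\<tau>. norm_L2 M (\<lambda>x. (a \<tau> x + a t x) - 2 * a t x)) \<longlongrightarrow> 0) (at t within S)"
    using tendsto_norm_L2_diff_if_difference_quotient[OF assms] by simp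
  have "((\<lambda>\<tau>. \<integral>x. ?q \<tau> x * (a \<tau> x + a t x) \<partial>M) \<longlongrightarrow> (\<integral>x. b x * (2 * a t x) \<partial>M)) (at t within S)"
    by (intro tendsto_integral_mult_L2 lim sum_lim eventually_mono[OF S] q b square_integrable_add
        square_integrable_cmult a t)
  moreover have "\<forall>\<^sub>F \<tau> in at t within S. (\<integral>x. ?q \<tau> x * (a \<tau> x + a t x) \<partial>M)
      = ((norm_L2 M (a \<tau>))^2 - (norm_L2 M (a t))^2) / (\<tau> - t)"
    using S
  proof eventually_elim
    case (elim \<tau>)
    have "(\<integral>x. ?q \<tau> x * (a \<tau> x + a t x) \<partial>M) = (\<integral>x. ((a \<tau> x)^2 - (a t x)^2) / (\<tau> - t) \<partial>M)"
      by (rule Bochner_Integration.integral_cong) (simp_all add: power2_eq_square algebra_simps)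
    then show ?case
      using a[of \<tau>] a[OF t] elim by (simp add: norm_L2_power2 square_integrable_power2)
  qed
  ultimately show ?thesis
    by (simp add: has_field_derivative_iff mult.commute[of "b _"] mult.assoc
        Lim_transform_eventually)
qed

section \<open>Smooth functions on the real line\<close>

definition smooth :: "(real \<Rightarrow> real) \<Rightarrow> bool" where
  "smooth f \<longleftrightarrow> (\<forall>k x. (deriv ^^ k) f differentiable (at x))"

lemma smooth_DERIV: "smooth f \<Longrightarrow> DERIV f x :> deriv f x"
  unfolding smooth_def DERIV_deriv_iff_real_differentiable by (metis funpow_0)

lemma smooth_deriv: "smooth f \<Longrightarrow> smooth (deriv f)"
  unfolding smooth_def by (metis comp_apply funpow_Suc_right)

lemma smooth_continuous_on: "smooth f \<Longrightarrow> continuous_on S f"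
  by (meson DERIV_continuous_on has_field_derivative_at_within smooth_DERIV)

lemma smooth_coinduct [consumes 1, case_names deriv]:
  assumes "f \<in> S" and deriv: "\<And>g. g \<in> S \<Longrightarrow> \<exists>g'\<in>S. \<forall>x. DERIV g x :> g' x"
  shows "smooth f"
proof -
  have closed: "deriv g \<in> S" "g differentiable (at x)" if "g \<in> S" for g x
  proof -
    obtain g' where g': "g' \<in> S" "\<forall>x. DERIV g x :> g' x"
      using deriv[OF \<open>g \<in> S\<close>] by blast
    then have "deriv g = g'"
      by (auto intro: DERIV_imp_deriv)
    then show "deriv g \<in> S" "g differentiable (at x)"
      using g' by (auto simp: real_differentiable_def)
  qed
  have "(deriv ^^ k) f \<in> S" for k
    by (induction k) (simp_all add: assms(1) closed(1))
  then show ?thesis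
    unfolding smooth_def using closed(2) by blast
qed

lemma smooth_if_DERIV_smooth:
  assumes "\<And>x. DERIV f x :> f' x" "smooth f'"
  shows "smooth f"
proof (rule smooth_coinduct[of f "insert f (Collect smooth)"])
  fix g assume "g \<in> insert f (Collect smooth)"
  then show "\<exists>g'\<in>insert f (Collect smooth). \<forall>x. DERIV g x :> g' x"
    using assms smooth_DERIV smooth_deriv by blast
qed simp

text \<open>Leibniz' rule turns a product into a sum of products, so coinduction needs the sums as well.\<close>

inductive_set smooth_products :: "(real \<Rightarrow> real) set" where
  mult: "smooth f \<Longrightarrow> smooth g \<Longrightarrow> (\<lambda>x. f x * g x) \<in> smooth_products"
| add: "p \<in> smooth_products \<Longrightarrow> q \<in> smooth_products \<Longrightarrow> (\<lambda>x. p x + q x) \<in> smooth_products"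

lemma smooth_mult:
  assumes "smooth f" "smooth g"
  shows "smooth (\<lambda>x. f x * g x)"
proof (rule smooth_coinduct[of _ smooth_products])
  show "(\<lambda>x. f x * g x) \<in> smooth_products"
    using assms by (rule smooth_products.mult)
  fix p assume "p \<in> smooth_products"
  then show "\<exists>p'\<in>smooth_products. \<forall>x. DERIV p x :> p' x"
  proof induction
    case (mult f g)
    have "\<forall>x. DERIV (\<lambda>x. f x * g x) x :> deriv f x * g x + deriv g x * f x"
      using mult by (intro allI DERIV_mult smooth_DERIV)
    moreover have "(\<lambda>x. deriv f x * g x + deriv g x * f x) \<in> smooth_products"
      using mult by (intro smooth_products.intros smooth_deriv)
    ultimately show ?case
      by (rule bexI)
  next
    case (add p q)
    then obtain p' q' where "p' \<in> smooth_products" "q' \<in> smooth_products"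
      "\<And>x. DERIV p x :> p' x" "\<And>x. DERIV q x :> q' x"
      by blast
    then show ?case
      by (intro bexI[of _ "\<lambda>x. p' x + q' x"] allI DERIV_add smooth_products.add)
  qed
qed

lemma smooth_diff:
  assumes "smooth f" "smooth g"
  shows "smooth (\<lambda>x. f x - g x)"
proof (rule smooth_coinduct[of _ "{\<lambda>x. f x - g x |f g. smooth f \<and> smooth g}"])
  fix h assume "h \<in> {\<lambda>x. f x - g x |f g. smooth f \<and> smooth g}"
  then obtain f g where "h = (\<lambda>x. f x - g x)" "smooth f" "smooth g"
    by blast
  then have "\<forall>x. DERIV h x :> deriv f x - deriv g x"
    "(\<lambda>x. deriv f x - deriv g x) \<in> {\<lambda>x. f x - g x |f g. smooth f \<and> smooth g}"
    by (auto intro!: DERIV_diff smooth_DERIV intro: smooth_deriv)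
  then show "\<exists>h'\<in>{\<lambda>x. f x - g x |f g. smooth f \<and> smooth g}. \<forall>x. DERIV h x :> h' x"
    by (rule bexI)
qed (use assms in blast)

lemma smooth_cmult_affine:
  assumes "smooth f"
  shows "smooth (\<lambda>x. c * f (a * x + b))"
proof (rule smooth_coinduct[of _ "{\<lambda>x. c * f (a * x + b) |c f. smooth f}"])
  fix g assume "g \<in> {\<lambda>x. c * f (a * x + b) |c f. smooth f}"
  then obtain c f where g: "g = (\<lambda>x. c * f (a * x + b))" and f: "smooth f"
    by blast
  have "\<forall>x. DERIV g x :> c * a * deriv f (a * x + b)"
  proof
    fix x
    have "DERIV (\<lambda>x. f (a * x + b)) x :> deriv f (a * x + b) * a"
      by (rule DERIV_chain2[OF smooth_DERIV[OF f]]) (auto intro!: derivative_eq_intros)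
    from DERIV_cmult[OF this, of c] show "DERIV g x :> c * a * deriv f (a * x + b)"
      by (simp add: g mult_ac)
  qed
  moreover have "(\<lambda>x. c * a * deriv f (a * x + b)) \<in> {\<lambda>x. c * f (a * x + b) |c f. smooth f}"
    using smooth_deriv[OF f] by blast
  ultimately show "\<exists>g'\<in>{\<lambda>x. c * f (a * x + b) |c f. smooth f}. \<forall>x. DERIV g x :> g' x"
    by (rule bexI)
qed (use assms in blast)

text \<open>The polynomial factor makes the family closed under differentiation.\<close>

definition flat_exp :: "real poly \<Rightarrow> real \<Rightarrow> real" where
  "flat_exp p x = (if x > 0 then poly p (1 / x) * exp (- 1 / x) else 0)"

lemma tendsto_poly_div_exp_0:
  fixes p :: "real poly"
  shows "((\<lambda>y. poly p y / exp y) \<longlongrightarrow> 0) at_top"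
proof -
  have "((\<lambda>y. \<Sum>i\<le>degree p. coeff p i * (y ^ i / exp y)) \<longlongrightarrow> 0) at_top"
    by (intro tendsto_null_sum tendsto_mult_right_zero tendsto_power_div_exp_0)
  then show ?thesis
    by (simp add: poly_altdef sum_divide_distrib)
qed

lemma DERIV_flat_exp_0: "DERIV (flat_exp p) 0 :> 0"
proof -
  have "((\<lambda>h. poly (pCons 0 p) (inverse h) / exp (inverse h)) \<longlongrightarrow> 0) (at_right 0)"
    by (rule filterlim_compose[OF tendsto_poly_div_exp_0 filterlim_inverse_at_top_right])
  then have "((\<lambda>h. flat_exp p h / h) \<longlongrightarrow> 0) (at_right 0)"
    by (rule Lim_transform_eventually)
      (auto simp: eventually_at_filter flat_exp_def field_simps exp_minus)
  moreover have "((\<lambda>h. flat_exp p h / h) \<longlongrightarrow> 0) (at_left 0)"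
    by (rule Lim_transform_eventually[OF tendsto_const])
      (auto simp: eventually_at_filter flat_exp_def)
  ultimately have "((\<lambda>h. flat_exp p h / h) \<longlongrightarrow> 0) (at 0)"
    by (simp add: filterlim_split_at)
  then show ?thesis
    by (simp add: DERIV_def flat_exp_def)
qed

lemma DERIV_flat_exp: "DERIV (flat_exp p) x :> flat_exp ([:0, 0, 1:] * (p - pderiv p)) x"
proof (cases x "0 :: real" rule: linorder_cases)
  case less
  then have "\<forall>\<^sub>F y in nhds x. flat_exp p y = 0"
    using eventually_nhds_in_open[of "{..<0}" x] by (auto elim!: eventually_mono simp: flat_exp_def)
  with less show ?thesis
    by (subst DERIV_cong_ev[OF refl _ refl, where g = "\<lambda>_. 0"]) (auto simp: flat_exp_def)
next
  case equal
  then show ?thesis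
    using DERIV_flat_exp_0 by (simp add: flat_exp_def)
next
  case greater
  then have "\<forall>\<^sub>F y in nhds x. flat_exp p y = poly p (1 / y) * exp (- 1 / y)"
    using eventually_nhds_in_open[of "{0<..}" x] by (auto elim!: eventually_mono simp: flat_exp_def)
  moreover have "DERIV (\<lambda>x. poly p (1 / x) * exp (- 1 / x)) x :>
      flat_exp ([:0, 0, 1:] * (p - pderiv p)) x"
    using greater by (auto intro!: derivative_eq_intros DERIV_chain2[OF poly_DERIV]
        simp: flat_exp_def field_simps power2_eq_square)
  ultimately show ?thesis
    by (subst DERIV_cong_ev[OF refl _ refl])
qed

lemma smooth_flat_exp: "smooth (flat_exp p)"
  by (rule smooth_coinduct[of _ "range flat_exp"]) (auto intro: DERIV_flat_exp)

lemma flat_exp_1_bounds: "0 \<le> flat_exp 1 x" "flat_exp 1 x \<le> 1"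
  by (auto simp: flat_exp_def)

lemma tendsto_flat_exp_1:
  assumes "filterlim f at_top F"
  shows "((\<lambda>t. flat_exp 1 (f t)) \<longlongrightarrow> 1) F"
proof -
  have "((\<lambda>t. exp (- (1 / f t))) \<longlongrightarrow> exp (- 0)) F"
    using assms by (intro tendsto_intros real_tendsto_divide_at_top[OF tendsto_const])
  moreover have "\<forall>\<^sub>F t in F. f t > 0"
    using assms by (simp add: filterlim_at_top_dense)
  ultimately show ?thesis
    by (auto elim!: Lim_transform_eventually eventually_mono simp: flat_exp_def)
qed

definition cutoff :: "real \<Rightarrow> real \<Rightarrow> nat \<Rightarrow> real \<Rightarrow> real" where
  "cutoff a b n x = flat_exp 1 (real n * (x - a) - 1) * flat_exp 1 (real n * (b - x) - 1)"

lemma smooth_cutoff: "smooth (cutoff a b n)"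
  using smooth_mult[OF smooth_cmult_affine[OF smooth_flat_exp, of 1 1 n "- n * a - 1"]
      smooth_cmult_affine[OF smooth_flat_exp, of 1 1 "- n" "n * b - 1"]]
  by (simp add: cutoff_def[abs_def] algebra_simps)

lemma abs_cutoff_le_1: "\<bar>cutoff a b n x\<bar> \<le> 1"
  unfolding cutoff_def using flat_exp_1_bounds by (simp add: abs_mult mult_le_one)

lemma cutoff_eq_0:
  assumes "0 < n" "x \<notin> {a + 1 / n..b - 1 / n}"
  shows "cutoff a b n x = 0"
  using assms by (auto simp: cutoff_def flat_exp_def field_simps)

lemma cutoff_tendsto_indicator: "(\<lambda>n. cutoff a b n x) \<longlonglongrightarrow> indicator {a<..<b} x"
proof (cases "x \<in> {a<..<b}")
  case True
  have "(\<lambda>n. flat_exp 1 (real n * c - 1)) \<longlonglongrightarrow> 1" if "0 < c" for c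
  proof (rule tendsto_flat_exp_1)
    have "LIM n sequentially. real n * c :> at_top"
      by (rule filterlim_at_top_mult_tendsto_pos[OF tendsto_const that filterlim_real_sequentially])
    from filterlim_tendsto_add_at_top[OF tendsto_const this, of "- 1"]
    show "LIM n sequentially. real n * c - 1 :> at_top"
      by simp
  qed
  from tendsto_mult[OF this this, of "x - a" "b - x"] show ?thesis
    using True by (simp add: cutoff_def)
next
  case False
  then have "cutoff a b n x = 0" for n
    using mult_nonneg_nonpos[of "real n" "x - a"] mult_nonneg_nonpos[of "real n" "b - x"]
    by (auto simp: cutoff_def flat_exp_def)
  with False show ?thesis by simp
qed

section \<open>Primitives and integration by parts\<close>

definition primitive :: "real measure \<Rightarrow> (real \<Rightarrow> real) \<Rightarrow> real \<Rightarrow> real" where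
  "primitive M f x = (LINT y:{..<x}|M. f y)"

locale atomless_line_measure = sigma_finite_measure M for M :: "real measure" +
  assumes ident_borel_measurable [measurable]: "(\<lambda>x. x) \<in> borel_measurable M"
    and AE_neq: "AE x in M. x \<noteq> y"
begin

lemma set_integrable_lessThan:
  fixes f :: "real \<Rightarrow> real"
  assumes f: "integrable M f"
  shows "set_integrable M {..<x} f"
proof -
  have "indicator {..<x} = (\<lambda>y. if y < x then 1 else 0 :: real)"
    by (auto simp: indicator_def)
  moreover have "(\<lambda>y. if y < x then 1 else 0 :: real) \<in> borel_measurable M"
    by measurable
  ultimately have "(\<lambda>y. indicator {..<x} y *\<^sub>R f y) \<in> borel_measurable M"
    using f by (intro borel_measurable_scaleR) auto
  then show ?thesis
    unfolding set_integrable_def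
    by (rule Bochner_Integration.integrable_bound[OF f]) (simp add: indicator_def)
qed

lemma tendsto_primitive:
  fixes f :: "real \<Rightarrow> real"
  assumes f: "integrable M f" and lim: "X \<longlonglongrightarrow> x"
  shows "(\<lambda>n. primitive M f (X n)) \<longlonglongrightarrow> primitive M f x"
  unfolding primitive_def set_lebesgue_integral_def
proof (rule integral_dominated_convergence[where w = "\<lambda>y. \<bar>f y\<bar>"])
  show "(\<lambda>y. indicator {..<x} y *\<^sub>R f y) \<in> borel_measurable M"
    "(\<lambda>y. indicator {..<X n} y *\<^sub>R f y) \<in> borel_measurable M" for n
    using set_integrable_lessThan[OF f] unfolding set_integrable_def by auto
  show "AE y in M. (\<lambda>n. indicator {..<X n} y *\<^sub>R f y) \<longlonglongrightarrow> indicator {..<x} y *\<^sub>R f y"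
    using AE_neq[of x]
  proof eventually_elim
    case (elim y)
    then have "\<forall>\<^sub>F n in sequentially. indicator {..<X n} y = (indicator {..<x} y :: real)"
      using order_tendstoD[OF lim, of y]
      by (cases "y < x") (auto elim!: eventually_mono simp: indicator_def)
    then show ?case
      by (intro tendsto_eventually) (auto elim!: eventually_mono)
  qed
  show "AE y in M. norm (indicator {..<X n} y *\<^sub>R f y) \<le> \<bar>f y\<bar>" for n
    by (simp add: indicator_def)
qed (use f in simp)

lemma continuous_on_primitive: "integrable M f \<Longrightarrow> continuous_on S (primitive M f)"
  using tendsto_primitive by (auto simp: continuous_on_sequentially o_def)

lemma abs_primitive_le:
  assumes "integrable M f"
  shows "\<bar>primitive M f x\<bar> \<le> (\<integral>y. \<bar>f y\<bar> \<partial>M)"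
proof -
  have int: "integrable M (\<lambda>y. indicator {..<x} y *\<^sub>R f y)"
    using set_integrable_lessThan[OF assms] by (simp add: set_integrable_def)
  then have "\<bar>primitive M f x\<bar> \<le> (\<integral>y. \<bar>indicator {..<x} y *\<^sub>R f y\<bar> \<partial>M)"
    unfolding primitive_def set_lebesgue_integral_def by (intro integral_abs_bound)
  also have "\<dots> \<le> (\<integral>y. \<bar>f y\<bar> \<partial>M)"
    using assms int by (intro integral_mono) (auto simp: indicator_def)
  finally show ?thesis .
qed

lemma integrable_mult_primitive:
  assumes "integrable M f" "integrable M g"
  shows "integrable M (\<lambda>x. f x * primitive M g x)"
proof (rule Bochner_Integration.integrable_bound)
  show "integrable M (\<lambda>x. f x * (\<integral>y. \<bar>g y\<bar> \<partial>M))"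
    using assms(1) by simp
  have "primitive M g \<in> borel_measurable borel"
    by (rule borel_measurable_continuous_onI[OF continuous_on_primitive[OF assms(2)]])
  then have "primitive M g \<in> borel_measurable M"
    by (rule measurable_compose[OF ident_borel_measurable, of "primitive M g" borel])
  then show "(\<lambda>x. f x * primitive M g x) \<in> borel_measurable M"
    using borel_measurable_integrable[OF assms(1)] by (rule borel_measurable_times[rotated])
  show "AE x in M. norm (f x * primitive M g x) \<le> norm (f x * (\<integral>y. \<bar>g y\<bar> \<partial>M))"
  proof (rule AE_I2)
    fix x
    have "\<bar>primitive M g x\<bar> \<le> \<bar>\<integral>y. \<bar>g y\<bar> \<partial>M\<bar>"
      using abs_primitive_le[OF assms(2), of x] by linarith
    then show "norm (f x * primitive M g x) \<le> norm (f x * (\<integral>y. \<bar>g y\<bar> \<partial>M))"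
      unfolding real_norm_def abs_mult by (rule mult_left_mono) simp
  qed
qed

lemma integral_greaterThan_eq:
  fixes g :: "real \<Rightarrow> real"
  assumes g: "integrable M g"
  shows "(\<integral>x. (if y < x then g x else 0) \<partial>M) = (\<integral>x. g x \<partial>M) - primitive M g y"
proof -
  note [measurable] = borel_measurable_integrable[OF g]
  have lower: "integrable M (\<lambda>x. indicator {..<y} x *\<^sub>R g x)"
    using set_integrable_lessThan[OF g] by (simp add: set_integrable_def)
  have upper: "integrable M (\<lambda>x. if y < x then g x else 0)"
    by (rule Bochner_Integration.integrable_bound[OF g]) auto
  have "(\<integral>x. g x \<partial>M) = (\<integral>x. indicator {..<y} x *\<^sub>R g x + (if y < x then g x else 0) \<partial>M)"
    using AE_neq[of y] lower by (intro integral_cong_AE) (auto elim!: eventually_mono)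
  then show ?thesis
    using lower upper by (simp add: primitive_def set_lebesgue_integral_def)
qed

lemma integral_primitive_mult:
  fixes f g :: "real \<Rightarrow> real"
  assumes f: "integrable M f" and g: "integrable M g"
  shows "(\<integral>x. primitive M f x * g x \<partial>M)
    = (\<integral>x. f x \<partial>M) * (\<integral>x. g x \<partial>M) - (\<integral>x. f x * primitive M g x \<partial>M)"
proof -
  interpret pair_sigma_finite M M ..
  note [measurable] = borel_measurable_integrable[OF f] borel_measurable_integrable[OF g]
  let ?T = "\<lambda>x y. if y < x then f y * g x else 0"
  have "integrable (M \<Otimes>\<^sub>M M) (\<lambda>(x, y). f y * g x)"
    using f g by (intro Fubini_integrable) (auto simp: abs_mult)
  then have T: "integrable (M \<Otimes>\<^sub>M M) (case_prod ?T)"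
    by (rule Bochner_Integration.integrable_bound) auto
  have "(\<integral>x. primitive M f x * g x \<partial>M) = (\<integral>x. (\<integral>y. ?T x y \<partial>M) \<partial>M)"
  proof (rule Bochner_Integration.integral_cong)
    fix x
    have "primitive M f x * g x = (\<integral>y. indicator {..<x} y *\<^sub>R f y * g x \<partial>M)"
      by (simp add: primitive_def set_lebesgue_integral_def)
    also have "\<dots> = (\<integral>y. ?T x y \<partial>M)"
      by (rule Bochner_Integration.integral_cong) (auto simp: indicator_def)
    finally show "primitive M f x * g x = (\<integral>y. ?T x y \<partial>M)" .
  qed simp
  also have "\<dots> = (\<integral>y. (\<integral>x. ?T x y \<partial>M) \<partial>M)"
    using T by (rule Fubini_integral[symmetric])
  also have "\<dots> = (\<integral>y. f y * ((\<integral>x. g x \<partial>M) - primitive M g y) \<partial>M)"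
  proof (rule Bochner_Integration.integral_cong)
    fix y
    have "(\<integral>x. ?T x y \<partial>M) = (\<integral>x. f y * (if y < x then g x else 0) \<partial>M)"
      by (rule Bochner_Integration.integral_cong) auto
    then show "(\<integral>x. ?T x y \<partial>M) = f y * ((\<integral>x. g x \<partial>M) - primitive M g y)"
      by (simp add: integral_greaterThan_eq[OF g])
  qed simp
  also have "\<dots> = (\<integral>x. f x \<partial>M) * (\<integral>x. g x \<partial>M) - (\<integral>x. f x * primitive M g x \<partial>M)"
    using f integrable_mult_primitive[OF f g] by (simp add: right_diff_distrib)
  finally show ?thesis .
qed

end

lemma AE_eq_0_if_integral_greaterThan_eq_0:
  fixes f :: "real \<Rightarrow> real"
  assumes "sigma_finite_measure M" and sets: "sets M = sets borel" and f: "integrable M f"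
    and zero: "\<And>x. (LINT y:{x<..}|M. f y) = 0"
  shows "AE x in M. f x = 0"
proof (rule sigma_finite_measure.density_zero[OF assms(1) f])
  \<comment> \<open>\<open>ennreal\<close> cuts off negative values: \<open>part f\<close> and \<open>part (- f)\<close> have the positive and the
    negative part of \<open>f\<close> as densities.\<close>
  define part where "part g = density M (\<lambda>x. ennreal (g x))" for g
  note [measurable] = borel_measurable_integrable[OF f] and [measurable_cong] = sets
  have part: "emeasure (part g) A = (\<integral>\<^sup>+x. ennreal (indicator A x *\<^sub>R g x) \<partial>M)"
    if "A \<in> sets M" "g \<in> borel_measurable M" for A g
    using that unfolding part_def
    by (subst emeasure_density) (auto intro!: nn_integral_cong simp: indicator_def)
  have int: "integrable M (\<lambda>x. indicator A x *\<^sub>R f x)" if "A \<in> sets M" for A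
    using f that by (rule integrable_mult_indicator[rotated])
  have split: "(LINT y:A|M. f y)
      = enn2real (emeasure (part f) A) - enn2real (emeasure (part (\<lambda>x. - f x)) A)"
    if "A \<in> sets M" for A
    using real_lebesgue_integral_def[OF int[OF that]] that
    by (simp add: set_lebesgue_integral_def part)
  have finite: "emeasure (part f) A < \<infinity>" "emeasure (part (\<lambda>x. - f x)) A < \<infinity>" if "A \<in> sets M" for A
    using int[OF that] that by (simp_all add: part real_integrable_def less_top)
  have "part f = part (\<lambda>x. - f x)"
  proof (rule measure_eqI_lessThan)
    fix x :: real
    have x: "{x<..} \<in> sets M" by (simp add: sets)
    show "emeasure (part f) {x<..} < \<infinity>"
      using finite(1)[OF x] .
    show "emeasure (part f) {x<..} = emeasure (part (\<lambda>x. - f x)) {x<..}"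
      using split[OF x] zero[of x] finite[OF x]
      by (metis ennreal_enn2real infinity_ennreal_def right_minus_eq)
  qed (simp_all add: part_def sets)
  then show "(LINT y:A|M. f y) = 0" if "A \<in> sets M" for A
    using split[OF that] by simp
qed

section \<open>The interval\<close>

abbreviation \<mu>\<^sub>I :: "real measure" where
  "\<mu>\<^sub>I \<equiv> restrict_space lborel Ival"

lemma Ival_sets [measurable, simp]: "Ival \<in> sets borel"
  by (simp add: Ival_def)

lemma space_Ival [simp]: "space \<mu>\<^sub>I = Ival"
  by (simp add: space_restrict_space)

lemma emeasure_space_Ival: "emeasure \<mu>\<^sub>I Ival = ennreal (1/2)"
  by (simp add: emeasure_restrict_space Ival_def)

lemma measure_space_Ival: "measure \<mu>\<^sub>I Ival = 1/2"
  by (simp add: measure_restrict_space Ival_def)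

lemma borel_measurable_IvalI: "f \<in> borel_measurable borel \<Longrightarrow> f \<in> borel_measurable \<mu>\<^sub>I"
  by (simp add: measurable_restrict_space1)

interpretation Ival: finite_measure \<mu>\<^sub>I
  by (intro finite_measureI) (simp add: emeasure_space_Ival)

interpretation Ival: atomless_line_measure \<mu>\<^sub>I
proof
  show "(\<lambda>x. x) \<in> borel_measurable \<mu>\<^sub>I"
    by (rule borel_measurable_IvalI) simp
  show "AE x in \<mu>\<^sub>I. x \<noteq> y" for y
    using AE_lborel_singleton[of y] by (auto simp: AE_restrict_space_iff elim: eventually_mono)
qed

lemma L2_mem_iff: "L2_mem f \<longleftrightarrow> square_integrable \<mu>\<^sub>I f"
  by (simp add: L2_mem_def square_integrable_def set_borel_measurable_def set_integrable_def
      borel_measurable_restrict_space_iff integrable_restrict_space)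

lemma set_lebesgue_integral_Ival:
  "(LINT x:Ival|lborel. f x) = (\<integral>x. f x \<partial>\<mu>\<^sub>I)" for f :: "real \<Rightarrow> real"
  by (simp add: set_lebesgue_integral_def integral_restrict_space)

lemma L2_norm_eq: "L2_norm f = norm_L2 \<mu>\<^sub>I f"
  by (simp add: L2_norm_def norm_L2_def set_lebesgue_integral_Ival)

lemma AE_Ival_iff: "(AE x in \<mu>\<^sub>I. P x) \<longleftrightarrow> (AE x in lborel. x \<in> Ival \<longrightarrow> P x)"
  by (simp add: AE_restrict_space_iff)

lemma continuous_on_Ival_measurable:
  fixes f :: "real \<Rightarrow> real"
  assumes "continuous_on {0..1/2} f"
  shows "f \<in> borel_measurable \<mu>\<^sub>I"
proof -
  have "continuous_on Ival f"
    using assms by (rule continuous_on_subset) (auto simp: Ival_def)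
  then show ?thesis
    using borel_measurable_continuous_on_restrict[of Ival f]
    by (simp add: sets_restrict_space cong: measurable_cong_sets)
qed

lemma continuous_on_Ival_bounded:
  fixes f :: "real \<Rightarrow> real"
  assumes "continuous_on {0..1/2} f"
  obtains B where "0 \<le> B" "\<And>x. x \<in> Ival \<Longrightarrow> \<bar>f x\<bar> \<le> B"
proof -
  have "bounded (f ` {0..1/2})"
    using assms by (intro compact_imp_bounded compact_continuous_image) auto
  then obtain B where "0 < B" "\<forall>x\<in>{0..1/2}. \<bar>f x\<bar> \<le> B"
    unfolding bounded_pos by auto
  then show ?thesis
    by (intro that[of B]) (auto simp: Ival_def)
qed

lemma square_integrable_continuous_Ival:
  assumes "continuous_on {0..1/2} f"
  shows "square_integrable \<mu>\<^sub>I f"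
  using continuous_on_Ival_bounded[OF assms] continuous_on_Ival_measurable[OF assms]
  by (metis Ival.square_integrable_if_bounded space_Ival)

lemma integrable_continuous_Ival:
  "continuous_on {0..1/2} f \<Longrightarrow> integrable \<mu>\<^sub>I f" for f :: "real \<Rightarrow> real"
  by (simp add: Ival.square_integrable_integrable square_integrable_continuous_Ival)

lemma integrable_continuous_mult_Ival:
  fixes b f :: "real \<Rightarrow> real"
  assumes b: "continuous_on {0..1/2} b" and f: "integrable \<mu>\<^sub>I f"
  shows "integrable \<mu>\<^sub>I (\<lambda>x. b x * f x)"
proof -
  obtain B where B: "0 \<le> B" "\<And>x. x \<in> Ival \<Longrightarrow> \<bar>b x\<bar> \<le> B"
    using continuous_on_Ival_bounded[OF b] by metis
  have "integrable \<mu>\<^sub>I (\<lambda>x. B * f x)"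
    using f by simp
  then show ?thesis
  proof (rule Bochner_Integration.integrable_bound)
    show "(\<lambda>x. b x * f x) \<in> borel_measurable \<mu>\<^sub>I"
      using continuous_on_Ival_measurable[OF b] f by auto
    show "AE x in \<mu>\<^sub>I. norm (b x * f x) \<le> norm (B * f x)"
      using B by (intro AE_I2) (auto simp: abs_mult intro: mult_right_mono)
  qed
qed

lemma square_integrable_continuous_mult_Ival:
  assumes b: "continuous_on {0..1/2} b" and f: "square_integrable \<mu>\<^sub>I f"
  shows "square_integrable \<mu>\<^sub>I (\<lambda>x. b x * f x)"
  unfolding square_integrable_def
proof
  show "(\<lambda>x. b x * f x) \<in> borel_measurable \<mu>\<^sub>I"
    by (intro borel_measurable_times continuous_on_Ival_measurable[OF b]
        square_integrable_measurable[OF f])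
  have "continuous_on {0..1/2} (\<lambda>x. (b x)^2)"
    using b by (intro continuous_intros)
  then show "integrable \<mu>\<^sub>I (\<lambda>x. (b x * f x)^2)"
    unfolding power_mult_distrib
    using square_integrable_power2[OF f] by (rule integrable_continuous_mult_Ival)
qed

lemma continuous_eq_0_if_AE_Ival:
  fixes w :: "real \<Rightarrow> real"
  assumes w: "continuous_on {0..1/2} w" and ae: "AE x in \<mu>\<^sub>I. w x = 0" and x: "x \<in> {0..1/2}"
  shows "w x = 0"
proof -
  let ?Z = "{x \<in> {0..1/2}. w x = 0}"
  have Z: "closed ?Z"
    using w by (intro continuous_closed_preimage_constant) auto
  have "AE x in lebesgue. x \<in> Ival \<longrightarrow> x \<in> ?Z"
    using ae unfolding AE_Ival_iff
    by (intro AE_completion) (auto simp: Ival_def elim!: eventually_mono)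
  then have "Ival \<subseteq> ?Z"
    using mem_closed_if_AE_lebesgue_open[OF _ Z, of Ival] by (auto simp: Ival_def)
  then have "closure Ival \<subseteq> ?Z"
    using Z by (rule closure_minimal)
  then show ?thesis
    using x by (auto simp: Ival_def)
qed

lemma primitive_Ival_0: "primitive \<mu>\<^sub>I f 0 = 0"
proof -
  have "primitive \<mu>\<^sub>I f 0 = (\<integral>x. 0 \<partial>\<mu>\<^sub>I)"
    unfolding primitive_def set_lebesgue_integral_def
    by (rule Bochner_Integration.integral_cong) (auto simp: Ival_def)
  then show ?thesis by simp
qed

lemma primitive_Ival_half: "primitive \<mu>\<^sub>I f (1/2) = (\<integral>x. f x \<partial>\<mu>\<^sub>I)"
  unfolding primitive_def set_lebesgue_integral_def
  by (rule Bochner_Integration.integral_cong) (auto simp: Ival_def)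

lemma primitive_Ival_DERIV:
  assumes "\<And>x. DERIV F x :> f x" "continuous_on UNIV f" "x \<in> {0..1/2}"
  shows "primitive \<mu>\<^sub>I f x = F x - F 0"
proof -
  have "primitive \<mu>\<^sub>I f x = (LINT y:{0<..<x}|lborel. f y)"
    unfolding primitive_def set_lebesgue_integral_def using assms(3)
    by (simp add: integral_restrict_space)
      (auto intro!: Bochner_Integration.integral_cong simp: indicator_def Ival_def)
  also have "\<dots> = (LBINT y=ereal 0..ereal x. f y)"
    using assms(3) by (simp add: interval_lebesgue_integral_def einterval_eq)
  also have "\<dots> = F x - F 0"
    using assms by (intro interval_integral_FTC_finite)
      (auto intro: continuous_on_subset has_field_derivative_at_within
        simp: has_real_derivative_iff_has_vector_derivative[symmetric])
  finally show ?thesis .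
qed

lemma norm_L2_indicator_Ival_power2_le:
  assumes "x \<le> y"
  shows "(norm_L2 \<mu>\<^sub>I (indicator {x..<y}))^2 \<le> y - x"
proof -
  have "(norm_L2 \<mu>\<^sub>I (indicator {x..<y}))^2 = (\<integral>z. indicator Ival z *\<^sub>R (indicator {x..<y} z)^2 \<partial>lborel)"
    by (simp add: norm_L2_power2 integral_restrict_space)
  also have "\<dots> = (\<integral>z. indicator (Ival \<inter> {x..<y}) z \<partial>lborel)"
    by (rule Bochner_Integration.integral_cong) (auto simp: indicator_def)
  also have "\<dots> = measure lborel (Ival \<inter> {x..<y})"
    by simp
  also have "\<dots> \<le> measure lborel {x..<y}"
    using assms by (intro measure_mono_fmeasurable fmeasurableI) auto
  finally show ?thesis
    using assms by simp
qed

lemma primitive_Ival_diff_eq: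
  assumes g: "integrable \<mu>\<^sub>I g" and le: "x \<le> y"
  shows "primitive \<mu>\<^sub>I g y - primitive \<mu>\<^sub>I g x = (\<integral>z. indicator {x..<y} z * g z \<partial>\<mu>\<^sub>I)"
proof -
  have int: "integrable \<mu>\<^sub>I (\<lambda>y. indicator {..<z} y *\<^sub>R g y)" for z
    using Ival.set_integrable_lessThan[OF g] by (simp add: set_integrable_def)
  have "primitive \<mu>\<^sub>I g y - primitive \<mu>\<^sub>I g x
      = (\<integral>z. indicator {..<y} z *\<^sub>R g z - indicator {..<x} z *\<^sub>R g z \<partial>\<mu>\<^sub>I)"
    unfolding primitive_def set_lebesgue_integral_def
    by (rule Bochner_Integration.integral_diff[OF int int, symmetric])
  also have "\<dots> = (\<integral>z. indicator {x..<y} z * g z \<partial>\<mu>\<^sub>I)"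
    using le by (intro Bochner_Integration.integral_cong) (auto simp: indicator_def)
  finally show ?thesis .
qed

lemma primitive_Ival_diff_power2_le:
  assumes g: "square_integrable \<mu>\<^sub>I g"
  shows "(primitive \<mu>\<^sub>I g x - primitive \<mu>\<^sub>I g y)^2 \<le> \<bar>x - y\<bar> * (norm_L2 \<mu>\<^sub>I g)^2"
proof (induction x y rule: linorder_wlog)
  case (le x y)
  let ?I = "indicator {x..<y} :: real \<Rightarrow> real"
  have I: "square_integrable \<mu>\<^sub>I ?I"
    by (rule Ival.square_integrable_if_bounded[where B = 1])
      (auto intro: borel_measurable_IvalI simp: indicator_def)
  have "\<bar>primitive \<mu>\<^sub>I g y - primitive \<mu>\<^sub>I g x\<bar> \<le> norm_L2 \<mu>\<^sub>I ?I * norm_L2 \<mu>\<^sub>I g"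
    using Cauchy_Schwarz_L2[OF I g]
    by (simp add: primitive_Ival_diff_eq[OF Ival.square_integrable_integrable[OF g] le])
  then have "(primitive \<mu>\<^sub>I g y - primitive \<mu>\<^sub>I g x)^2 \<le> (norm_L2 \<mu>\<^sub>I ?I * norm_L2 \<mu>\<^sub>I g)^2"
    by (simp flip: abs_le_square_iff)
  also have "\<dots> = (norm_L2 \<mu>\<^sub>I ?I)^2 * (norm_L2 \<mu>\<^sub>I g)^2"
    by (rule power_mult_distrib)
  also have "\<dots> \<le> \<bar>x - y\<bar> * (norm_L2 \<mu>\<^sub>I g)^2"
    using norm_L2_indicator_Ival_power2_le[OF le] le by (intro mult_right_mono) simp_all
  finally show ?case
    by (simp add: power2_commute)
next
  case (sym x y)
  then show ?case by (simp add: power2_commute abs_minus_commute)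
qed

lemma abs_primitive_Ival_le:
  assumes "square_integrable \<mu>\<^sub>I g" "x \<in> {0..1/2}"
  shows "\<bar>primitive \<mu>\<^sub>I g x\<bar> \<le> norm_L2 \<mu>\<^sub>I g"
proof -
  have "(primitive \<mu>\<^sub>I g x)^2 \<le> \<bar>x\<bar> * (norm_L2 \<mu>\<^sub>I g)^2"
    using primitive_Ival_diff_power2_le[OF assms(1), of x 0] by (simp add: primitive_Ival_0)
  also have "\<dots> \<le> 1 * (norm_L2 \<mu>\<^sub>I g)^2"
    using assms(2) by (intro mult_right_mono) auto
  finally show ?thesis
    by (simp add: abs_le_square_iff[symmetric])
qed

section \<open>Test functions and weak derivatives\<close>

lemma test_fun_iff:
  "test_fun \<phi> \<longleftrightarrow> smooth \<phi> \<and> (\<exists>a b. 0 < a \<and> a \<le> b \<and> b < 1/2 \<and> (\<forall>x. x \<notin> {a..b} \<longrightarrow> \<phi> x = 0))"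
  unfolding test_fun_def smooth_def by blast

lemma test_fun_smooth: "test_fun \<phi> \<Longrightarrow> smooth \<phi>"
  by (simp add: test_fun_iff)

lemma test_fun_DERIV: "test_fun \<phi> \<Longrightarrow> DERIV \<phi> x :> deriv \<phi> x"
  by (simp add: test_fun_smooth smooth_DERIV)

lemma test_fun_continuous_on: "test_fun \<phi> \<Longrightarrow> continuous_on S \<phi>"
  by (simp add: test_fun_smooth smooth_continuous_on)

lemma test_fun_boundary: "test_fun \<phi> \<Longrightarrow> \<phi> 0 = 0" "test_fun \<phi> \<Longrightarrow> \<phi> (1/2) = 0"
  by (auto simp: test_fun_iff)

lemma test_fun_mult_smooth: "test_fun \<phi> \<Longrightarrow> smooth f \<Longrightarrow> test_fun (\<lambda>x. \<phi> x * f x)"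
  unfolding test_fun_iff by (metis mult_zero_left smooth_mult)

lemma test_fun_cmult: "test_fun \<phi> \<Longrightarrow> test_fun (\<lambda>x. c * \<phi> x)"
  unfolding test_fun_iff using smooth_cmult_affine[of \<phi> c 1 0] by auto

lemma test_fun_diff:
  assumes "test_fun \<phi>" "test_fun \<psi>"
  shows "test_fun (\<lambda>x. \<phi> x - \<psi> x)"
proof -
  obtain a b where \<phi>: "0 < a" "a \<le> b" "b < 1/2" "\<And>x. x \<notin> {a..b} \<Longrightarrow> \<phi> x = 0"
    using assms(1) by (auto simp: test_fun_iff)
  obtain c d where \<psi>: "0 < c" "c \<le> d" "d < 1/2" "\<And>x. x \<notin> {c..d} \<Longrightarrow> \<psi> x = 0"
    using assms(2) by (auto simp: test_fun_iff)
  have "0 < min a c" "min a c \<le> max b d" "max b d < 1/2"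
    using \<phi> \<psi> by auto
  moreover have "\<phi> x - \<psi> x = 0" if "x \<notin> {min a c..max b d}" for x
    using that \<phi>(4)[of x] \<psi>(4)[of x] by (auto simp: min_le_iff_disj le_max_iff_disj)
  ultimately show ?thesis
    using assms unfolding test_fun_iff by (blast intro: smooth_diff)
qed

lemma test_fun_deriv:
  assumes "test_fun \<phi>"
  shows "test_fun (deriv \<phi>)"
proof -
  obtain a b where ab: "0 < a" "a \<le> b" "b < 1/2" "\<And>x. x \<notin> {a..b} \<Longrightarrow> \<phi> x = 0"
    using assms by (auto simp: test_fun_iff)
  have "deriv \<phi> x = 0" if "x \<notin> {a..b}" for x
  proof -
    have "\<forall>\<^sub>F y in nhds x. \<phi> y = 0"
      using eventually_nhds_in_open[of "- {a..b}" x] that ab(4)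
      by (simp add: open_Compl eventually_mono)
    then have "DERIV \<phi> x :> 0"
      by (subst DERIV_cong_ev[OF refl _ refl, where g = "\<lambda>_. 0"]) auto
    then show ?thesis by (rule DERIV_imp_deriv)
  qed
  with ab show ?thesis
    using assms unfolding test_fun_iff by (blast intro: smooth_deriv)
qed

lemma test_fun_square_integrable: "test_fun \<phi> \<Longrightarrow> square_integrable \<mu>\<^sub>I \<phi>"
  by (simp add: square_integrable_continuous_Ival test_fun_continuous_on)

lemma test_fun_integrable: "test_fun \<phi> \<Longrightarrow> integrable \<mu>\<^sub>I \<phi>"
  by (simp add: integrable_continuous_Ival test_fun_continuous_on)

lemma integrable_mult_test_fun:
  assumes "integrable \<mu>\<^sub>I f" "test_fun \<phi>"
  shows "integrable \<mu>\<^sub>I (\<lambda>x. f x * \<phi> x)"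
  using integrable_continuous_mult_Ival[OF test_fun_continuous_on[OF assms(2)] assms(1)]
  by (simp add: mult.commute)

lemma test_fun_eq_primitive_deriv:
  assumes "test_fun \<phi>" "x \<in> {0..1/2}"
  shows "\<phi> x = primitive \<mu>\<^sub>I (deriv \<phi>) x"
  using primitive_Ival_DERIV[OF test_fun_DERIV test_fun_continuous_on[OF test_fun_deriv],
      OF assms(1,1,2)] test_fun_boundary(1)[OF assms(1)]
  by simp

lemma test_fun_antiderivative:
  assumes \<psi>: "test_fun \<psi>" and mean: "(\<integral>x. \<psi> x \<partial>\<mu>\<^sub>I) = 0"
  obtains \<phi> where "test_fun \<phi>" "deriv \<phi> = \<psi>"
proof -
  obtain a b where ab: "0 < a" "a \<le> b" "b < 1/2" "\<And>x. x \<notin> {a..b} \<Longrightarrow> \<psi> x = 0"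
    using \<psi> by (auto simp: test_fun_iff)
  have "\<exists>F. \<forall>x. -\<infinity> < ereal x \<longrightarrow> ereal x < \<infinity> \<longrightarrow> (F has_vector_derivative \<psi> x) (at x)"
    using test_fun_continuous_on[OF \<psi>, of UNIV]
    by (intro einterval_antiderivative) (auto simp: continuous_on_eq_continuous_at)
  then obtain F where F: "DERIV F x :> \<psi> x" for x
    by (auto simp: has_real_derivative_iff_has_vector_derivative)
  have const: "F x = F y" if S: "convex S" "S \<inter> {a..b} = {}" "x \<in> S" "y \<in> S" for S x y
  proof -
    have "(F has_field_derivative 0) (at z within S)" if "z \<in> S" for z
    proof -
      have "\<psi> z = 0"
        using ab(4)[of z] that S(2) by blast
      then show ?thesis
        using F[of z] by (simp add: has_field_derivative_at_within)
    qed
    then show ?thesis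
      using has_field_derivative_zero_constant[OF S(1)] S(3,4) by metis
  qed
  define \<phi> where "\<phi> x = F x - F 0" for x
  have D: "DERIV \<phi> x :> \<psi> x" for x
    unfolding \<phi>_def using DERIV_diff[OF F DERIV_const] by simp
  have "F (1/2) = F 0"
    using primitive_Ival_DERIV[OF F test_fun_continuous_on[OF \<psi>], of "1/2"] mean
    by (simp add: primitive_Ival_half)
  then have "\<phi> x = 0" if "x \<notin> {a..b}" for x
    using that const[of "{..<a}" x 0] const[of "{b<..}" x "1/2"] ab by (force simp: \<phi>_def)
  then have "test_fun \<phi>"
    using ab smooth_if_DERIV_smooth[OF D test_fun_smooth[OF \<psi>]] unfolding test_fun_iff by blast
  moreover have "deriv \<phi> = \<psi>"
    using D by (auto intro: DERIV_imp_deriv)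
  ultimately show ?thesis by (rule that)
qed

lemma test_fun_cutoff:
  assumes "0 \<le> a" "b \<le> 1/2" "0 < n" "2 / real n \<le> b - a"
  shows "test_fun (cutoff a b n)"
proof -
  have "0 < 1 / real n" "1 / real n + 1 / real n \<le> b - a"
    using assms(3,4) by simp_all
  then have "0 < a + 1 / real n" "a + 1 / real n \<le> b - 1 / real n" "b - 1 / real n < 1/2"
    using assms(1,2) by linarith+
  then show ?thesis
    unfolding test_fun_iff using smooth_cutoff cutoff_eq_0[OF assms(3)] by blast
qed

lemma integral_interval_eq_0_if_test_fun_orthogonal:
  assumes h: "integrable \<mu>\<^sub>I h" and orth: "\<And>\<psi>. test_fun \<psi> \<Longrightarrow> (\<integral>x. h x * \<psi> x \<partial>\<mu>\<^sub>I) = 0"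
    and ab: "0 \<le> a" "a < b" "b \<le> 1/2"
  shows "(LINT x:{a<..<b}|\<mu>\<^sub>I. h x) = 0"
proof -
  have [measurable]: "cutoff a b n \<in> borel_measurable \<mu>\<^sub>I"
      "(indicator {a<..<b} :: real \<Rightarrow> real) \<in> borel_measurable \<mu>\<^sub>I" for n
    by (auto intro!: borel_measurable_IvalI borel_measurable_continuous_onI
        smooth_continuous_on smooth_cutoff)
  note [measurable] = borel_measurable_integrable[OF h]
  have "(\<lambda>n. \<integral>x. h x * cutoff a b n x \<partial>\<mu>\<^sub>I) \<longlonglongrightarrow> (\<integral>x. h x * indicator {a<..<b} x \<partial>\<mu>\<^sub>I)"
  proof (rule integral_dominated_convergence[where w = "\<lambda>x. \<bar>h x\<bar>"])
    show "AE x in \<mu>\<^sub>I. norm (h x * cutoff a b n x) \<le> \<bar>h x\<bar>" for n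
      using mult_left_mono[OF abs_cutoff_le_1 abs_ge_zero] by (simp add: abs_mult)
    show "AE x in \<mu>\<^sub>I. (\<lambda>n. h x * cutoff a b n x) \<longlonglongrightarrow> h x * indicator {a<..<b} x"
      by (intro AE_I2 tendsto_mult tendsto_const cutoff_tendsto_indicator)
  qed (use h in auto)
  moreover have "(\<lambda>n. \<integral>x. h x * cutoff a b n x \<partial>\<mu>\<^sub>I) \<longlonglongrightarrow> 0"
  proof (rule tendsto_eventually)
    have "\<forall>\<^sub>F n in sequentially. 2 / (b - a) \<le> real n"
      using eventually_compose_filterlim[OF eventually_ge_at_top filterlim_real_sequentially] .
    then show "\<forall>\<^sub>F n in sequentially. (\<integral>x. h x * cutoff a b n x \<partial>\<mu>\<^sub>I) = 0"
      using eventually_gt_at_top[of 0]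
    proof eventually_elim
      case (elim n)
      then have "2 / real n \<le> b - a"
        using ab(2) by (simp add: field_simps)
      then show ?case
        using ab elim(2) by (intro orth test_fun_cutoff)
    qed
  qed
  ultimately have "(\<integral>x. h x * indicator {a<..<b} x \<partial>\<mu>\<^sub>I) = 0"
    by (rule LIMSEQ_unique)
  then show ?thesis
    by (simp add: set_lebesgue_integral_def mult.commute)
qed

lemma AE_eq_0_if_test_fun_orthogonal:
  assumes h: "integrable \<mu>\<^sub>I h" and orth: "\<And>\<psi>. test_fun \<psi> \<Longrightarrow> (\<integral>x. h x * \<psi> x \<partial>\<mu>\<^sub>I) = 0"
  shows "AE x in \<mu>\<^sub>I. h x = 0"
proof -
  have "AE x in lborel. indicator Ival x *\<^sub>R h x = 0"
  proof (rule AE_eq_0_if_integral_greaterThan_eq_0)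
    show "integrable lborel (\<lambda>x. indicator Ival x *\<^sub>R h x)"
      using h by (simp add: integrable_restrict_space)
    fix a :: real
    have "(LINT x:{a<..}|lborel. indicator Ival x *\<^sub>R h x) = (LINT x:{max a 0<..<1/2}|\<mu>\<^sub>I. h x)"
      unfolding set_lebesgue_integral_def
      by (simp add: integral_restrict_space)
        (auto intro!: Bochner_Integration.integral_cong simp: indicator_def Ival_def)
    also have "\<dots> = 0"
    proof (cases "a < 1/2")
      case True
      then show ?thesis
        by (intro integral_interval_eq_0_if_test_fun_orthogonal h orth) auto
    qed (simp add: set_lebesgue_integral_def)
    finally show "(LINT x:{a<..}|lborel. indicator Ival x *\<^sub>R h x) = 0" .
  qed (simp_all add: lborel.sigma_finite_measure_axioms)
  then show ?thesis
    unfolding AE_Ival_iff by eventually_elim (auto simp: indicator_def)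
qed

lemma weak_deriv_iff:
  "weak_deriv f g \<longleftrightarrow> (\<forall>\<phi>. test_fun \<phi> \<longrightarrow>
    (\<integral>x. f x * deriv \<phi> x \<partial>\<mu>\<^sub>I) = - (\<integral>x. g x * \<phi> x \<partial>\<mu>\<^sub>I))"
  by (simp add: weak_deriv_def set_lebesgue_integral_Ival)

lemma weak_derivD:
  "weak_deriv f g \<Longrightarrow> test_fun \<phi> \<Longrightarrow>
    (\<integral>x. f x * deriv \<phi> x \<partial>\<mu>\<^sub>I) = - (\<integral>x. g x * \<phi> x \<partial>\<mu>\<^sub>I)"
  by (simp add: weak_deriv_iff)

lemma weak_deriv_cong:
  assumes "\<And>x. x \<in> Ival \<Longrightarrow> f x = f' x"
  shows "weak_deriv f g \<longleftrightarrow> weak_deriv f' g"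
proof -
  have "(\<integral>x. f x * \<phi> x \<partial>\<mu>\<^sub>I) = (\<integral>x. f' x * \<phi> x \<partial>\<mu>\<^sub>I)" for \<phi>
    using assms by (intro Bochner_Integration.integral_cong) auto
  then show ?thesis
    by (simp add: weak_deriv_iff)
qed

lemma weak_deriv_add:
  assumes "weak_deriv f f'" "weak_deriv g g'"
    and "integrable \<mu>\<^sub>I f" "integrable \<mu>\<^sub>I g" "integrable \<mu>\<^sub>I f'" "integrable \<mu>\<^sub>I g'"
  shows "weak_deriv (\<lambda>x. f x + g x) (\<lambda>x. f' x + g' x)"
  using assms unfolding weak_deriv_iff
  by (simp add: distrib_right integrable_mult_test_fun test_fun_deriv)

lemma weak_deriv_cmult:
  assumes "weak_deriv f f'"
  shows "weak_deriv (\<lambda>x. c * f x) (\<lambda>x. c * f' x)"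
  using assms unfolding weak_deriv_iff by (simp add: mult.assoc)

lemma weak_deriv_diff:
  assumes "weak_deriv f f'" "weak_deriv g g'"
    and "integrable \<mu>\<^sub>I f" "integrable \<mu>\<^sub>I g" "integrable \<mu>\<^sub>I f'" "integrable \<mu>\<^sub>I g'"
  shows "weak_deriv (\<lambda>x. f x - g x) (\<lambda>x. f' x - g' x)"
  using weak_deriv_add[OF assms(1) weak_deriv_cmult[OF assms(2), of "-1"]] assms(3-6) by simp

lemma weak_deriv_difference_quotient:
  assumes "weak_deriv f f'" "weak_deriv g g'" "weak_deriv k k'"
    and "integrable \<mu>\<^sub>I f" "integrable \<mu>\<^sub>I g" "integrable \<mu>\<^sub>I k"
    and "integrable \<mu>\<^sub>I f'" "integrable \<mu>\<^sub>I g'" "integrable \<mu>\<^sub>I k'"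
  shows "weak_deriv (\<lambda>x. (f x - g x) / h - k x) (\<lambda>x. (f' x - g' x) / h - k' x)"
proof -
  have "weak_deriv (\<lambda>x. (1 / h) * (f x - g x) - k x) (\<lambda>x. (1 / h) * (f' x - g' x) - k' x)"
    by (intro weak_deriv_diff weak_deriv_cmult integrable_mult_right
        Bochner_Integration.integrable_diff assms)
  then show ?thesis by simp
qed

lemma weak_deriv_unique:
  assumes "weak_deriv f g" "weak_deriv f g'" "integrable \<mu>\<^sub>I g" "integrable \<mu>\<^sub>I g'"
  shows "AE x in \<mu>\<^sub>I. g x = g' x"
proof -
  have "AE x in \<mu>\<^sub>I. g x - g' x = 0"
  proof (rule AE_eq_0_if_test_fun_orthogonal)
    fix \<psi> assume \<psi>: "test_fun \<psi>"
    then show "(\<integral>x. (g x - g' x) * \<psi> x \<partial>\<mu>\<^sub>I) = 0"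
      using weak_derivD[OF assms(1) \<psi>] weak_derivD[OF assms(2) \<psi>] assms(3,4)
      by (simp add: left_diff_distrib integrable_mult_test_fun)
  qed (use assms(3,4) in simp)
  then show ?thesis
    by eventually_elim simp
qed

lemma weak_deriv_primitive:
  assumes "integrable \<mu>\<^sub>I g"
  shows "weak_deriv (primitive \<mu>\<^sub>I g) g"
  unfolding weak_deriv_iff
proof (intro allI impI)
  fix \<phi> assume \<phi>: "test_fun \<phi>"
  have "(\<integral>x. deriv \<phi> x \<partial>\<mu>\<^sub>I) = 0"
    using test_fun_eq_primitive_deriv[OF \<phi>, of "1/2"] test_fun_boundary(2)[OF \<phi>]
    by (simp add: primitive_Ival_half)
  then have "(\<integral>x. primitive \<mu>\<^sub>I g x * deriv \<phi> x \<partial>\<mu>\<^sub>I)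
      = - (\<integral>x. g x * primitive \<mu>\<^sub>I (deriv \<phi>) x \<partial>\<mu>\<^sub>I)"
    using Ival.integral_primitive_mult[OF assms test_fun_integrable[OF test_fun_deriv[OF \<phi>]]]
    by simp
  also have "(\<integral>x. g x * primitive \<mu>\<^sub>I (deriv \<phi>) x \<partial>\<mu>\<^sub>I) = (\<integral>x. g x * \<phi> x \<partial>\<mu>\<^sub>I)"
    using test_fun_eq_primitive_deriv[OF \<phi>]
    by (intro Bochner_Integration.integral_cong) (auto simp: Ival_def)
  finally show "(\<integral>x. primitive \<mu>\<^sub>I g x * deriv \<phi> x \<partial>\<mu>\<^sub>I) = - (\<integral>x. g x * \<phi> x \<partial>\<mu>\<^sub>I)" .
qed

lemma test_fun_unit_mass:
  obtains \<eta> where "test_fun \<eta>" "(\<integral>x. \<eta> x \<partial>\<mu>\<^sub>I) = 1"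
proof -
  obtain \<psi> where \<psi>: "test_fun \<psi>" "(\<integral>x. \<psi> x \<partial>\<mu>\<^sub>I) \<noteq> 0"
  proof (rule ccontr)
    assume "\<not> thesis"
    with that have "AE x in \<mu>\<^sub>I. (1 :: real) = 0"
      by (intro AE_eq_0_if_test_fun_orthogonal) auto
    then show False
      using emeasure_space_Ival by (simp add: eventually_False ae_filter_eq_bot_iff)
  qed
  show ?thesis
    by (rule that[OF test_fun_cmult[OF \<psi>(1), of "1 / (\<integral>x. \<psi> x \<partial>\<mu>\<^sub>I)"]]) (use \<psi>(2) in simp)
qed

lemma weak_deriv_0_imp_AE_const:
  assumes w: "weak_deriv w (\<lambda>x. 0)" and int: "integrable \<mu>\<^sub>I w"
  obtains k where "AE x in \<mu>\<^sub>I. w x = k"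
proof -
  obtain \<eta> where \<eta>: "test_fun \<eta>" "(\<integral>x. \<eta> x \<partial>\<mu>\<^sub>I) = 1"
    by (rule test_fun_unit_mass)
  define k where "k = (\<integral>x. w x * \<eta> x \<partial>\<mu>\<^sub>I)"
  have "AE x in \<mu>\<^sub>I. w x - k = 0"
  proof (rule AE_eq_0_if_test_fun_orthogonal)
    fix \<psi> assume \<psi>: "test_fun \<psi>"
    define c where "c = (\<integral>x. \<psi> x \<partial>\<mu>\<^sub>I)"
    have "(\<integral>x. \<psi> x - c * \<eta> x \<partial>\<mu>\<^sub>I) = 0"
      using \<psi> \<eta> by (simp add: test_fun_integrable c_def)
    then obtain \<phi> where \<phi>: "test_fun \<phi>" "deriv \<phi> = (\<lambda>x. \<psi> x - c * \<eta> x)"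
      using test_fun_antiderivative[OF test_fun_diff[OF \<psi> test_fun_cmult[OF \<eta>(1)]]] by blast
    have "(\<integral>x. w x * (\<psi> x - c * \<eta> x) \<partial>\<mu>\<^sub>I) = 0"
      using weak_derivD[OF w \<phi>(1)] by (simp add: \<phi>(2))
    moreover have "(\<integral>x. w x * (\<psi> x - c * \<eta> x) \<partial>\<mu>\<^sub>I) = (\<integral>x. w x * \<psi> x - c * (w x * \<eta> x) \<partial>\<mu>\<^sub>I)"
      by (simp add: algebra_simps)
    ultimately have "(\<integral>x. w x * \<psi> x \<partial>\<mu>\<^sub>I) = c * k"
      using int \<psi> \<eta> by (simp add: integrable_mult_test_fun k_def)
    then show "(\<integral>x. (w x - k) * \<psi> x \<partial>\<mu>\<^sub>I) = 0"
      using int \<psi>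
      by (simp add: left_diff_distrib integrable_mult_test_fun test_fun_integrable c_def)
  qed (use int in simp)
  then have "AE x in \<mu>\<^sub>I. w x = k"
    by eventually_elim simp
  then show ?thesis by (rule that)
qed

lemma weak_deriv_imp_AE_primitive:
  assumes "weak_deriv f g" "integrable \<mu>\<^sub>I f" "integrable \<mu>\<^sub>I g"
  obtains k where "AE x in \<mu>\<^sub>I. f x = k + primitive \<mu>\<^sub>I g x"
proof -
  have int: "integrable \<mu>\<^sub>I (primitive \<mu>\<^sub>I g)"
    by (intro integrable_continuous_Ival Ival.continuous_on_primitive assms)
  have "weak_deriv (\<lambda>x. f x - primitive \<mu>\<^sub>I g x) (\<lambda>x. g x - g x)"
    by (intro weak_deriv_diff weak_deriv_primitive int assms)
  then obtain k where "AE x in \<mu>\<^sub>I. f x - primitive \<mu>\<^sub>I g x = k"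
    using weak_deriv_0_imp_AE_const[of "\<lambda>x. f x - primitive \<mu>\<^sub>I g x"] assms(2) int by auto
  then have "AE x in \<mu>\<^sub>I. f x = k + primitive \<mu>\<^sub>I g x"
    by eventually_elim simp
  then show ?thesis by (rule that)
qed

lemma weak_deriv_FTC:
  assumes "weak_deriv f g" "continuous_on {0..1/2} f" "integrable \<mu>\<^sub>I g" "x \<in> {0..1/2}"
  shows "f x = f 0 + primitive \<mu>\<^sub>I g x"
proof -
  obtain k where k: "AE x in \<mu>\<^sub>I. f x = k + primitive \<mu>\<^sub>I g x"
    using weak_deriv_imp_AE_primitive[OF assms(1) integrable_continuous_Ival[OF assms(2)] assms(3)] .
  have "f y - (k + primitive \<mu>\<^sub>I g y) = 0" if "y \<in> {0..1/2}" for y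
  proof (rule continuous_eq_0_if_AE_Ival[OF _ _ that])
    show "continuous_on {0..1/2} (\<lambda>y. f y - (k + primitive \<mu>\<^sub>I g y))"
      by (intro continuous_intros Ival.continuous_on_primitive assms)
    show "AE y in \<mu>\<^sub>I. f y - (k + primitive \<mu>\<^sub>I g y) = 0"
      using k by eventually_elim simp
  qed
  from this[OF assms(4)] this[of 0] show ?thesis
    by (simp add: primitive_Ival_0)
qed

text \<open>Both \<open>f\<close> and \<open>v\<close> are primitives up to a constant; that of \<open>v\<close> is \<open>v 0 = 0\<close>, and that of \<open>f\<close> is
  annihilated because \<open>v'\<close> has mean zero.\<close>

lemma weak_deriv_by_parts:
  assumes f: "weak_deriv f f'" "integrable \<mu>\<^sub>I f" "integrable \<mu>\<^sub>I f'"
    and v: "weak_deriv v v'" "continuous_on {0..1/2} v" "integrable \<mu>\<^sub>I v'" "v 0 = 0" "v (1/2) = 0"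
  shows "(\<integral>x. f x * v' x \<partial>\<mu>\<^sub>I) = - (\<integral>x. f' x * v x \<partial>\<mu>\<^sub>I)"
proof -
  obtain k where k: "AE x in \<mu>\<^sub>I. f x = k + primitive \<mu>\<^sub>I f' x"
    using weak_deriv_imp_AE_primitive[OF f] .
  have v_eq: "v x = primitive \<mu>\<^sub>I v' x" if "x \<in> {0..1/2}" for x
    using weak_deriv_FTC[OF v(1-3) that] v(4) by simp
  have mean: "(\<integral>x. v' x \<partial>\<mu>\<^sub>I) = 0"
    using v_eq[of "1/2"] v(5) by (simp add: primitive_Ival_half)
  have int: "integrable \<mu>\<^sub>I (\<lambda>x. primitive \<mu>\<^sub>I f' x * v' x)"
    using Ival.integrable_mult_primitive[OF v(3) f(3)] by (simp add: mult.commute)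
  have "(\<integral>x. f x * v' x \<partial>\<mu>\<^sub>I) = (\<integral>x. k * v' x + primitive \<mu>\<^sub>I f' x * v' x \<partial>\<mu>\<^sub>I)"
    using k by (intro integral_cong_AE)
      (use f(2) v(3) int in \<open>auto elim!: eventually_mono simp: distrib_right\<close>)
  also have "\<dots> = (\<integral>x. primitive \<mu>\<^sub>I f' x * v' x \<partial>\<mu>\<^sub>I)"
    using int v(3) mean by simp
  also have "\<dots> = - (\<integral>x. f' x * primitive \<mu>\<^sub>I v' x \<partial>\<mu>\<^sub>I)"
    using Ival.integral_primitive_mult[OF f(3) v(3)] mean by simp
  also have "(\<integral>x. f' x * primitive \<mu>\<^sub>I v' x \<partial>\<mu>\<^sub>I) = (\<integral>x. f' x * v x \<partial>\<mu>\<^sub>I)"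
    using v_eq by (intro Bochner_Integration.integral_cong) (auto simp: Ival_def)
  finally show ?thesis .
qed

lemma weak_deriv_mult_test_fun:
  assumes w: "weak_deriv w w'" "integrable \<mu>\<^sub>I w" "integrable \<mu>\<^sub>I w'" and \<phi>: "test_fun \<phi>"
  shows "weak_deriv (\<lambda>x. w x * \<phi> x) (\<lambda>x. w' x * \<phi> x + w x * deriv \<phi> x)"
  unfolding weak_deriv_iff
proof (intro allI impI)
  fix \<psi> assume \<psi>: "test_fun \<psi>"
  have "deriv (\<lambda>x. \<phi> x * \<psi> x) x = deriv \<phi> x * \<psi> x + deriv \<psi> x * \<phi> x" for x
    by (rule DERIV_imp_deriv[OF DERIV_mult[OF test_fun_DERIV[OF \<phi>] test_fun_DERIV[OF \<psi>]]])
  then have "(\<integral>x. w x * \<phi> x * deriv \<psi> x + w x * deriv \<phi> x * \<psi> x \<partial>\<mu>\<^sub>I)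
      = - (\<integral>x. w' x * \<phi> x * \<psi> x \<partial>\<mu>\<^sub>I)"
    using weak_derivD[OF w(1) test_fun_mult_smooth[OF \<phi> test_fun_smooth[OF \<psi>]]]
    by (simp add: algebra_simps)
  moreover have "test_fun (deriv \<phi>)" "test_fun (deriv \<psi>)"
    using \<phi> \<psi> by (auto intro: test_fun_deriv)
  ultimately show "(\<integral>x. w x * \<phi> x * deriv \<psi> x \<partial>\<mu>\<^sub>I)
      = - (\<integral>x. (w' x * \<phi> x + w x * deriv \<phi> x) * \<psi> x \<partial>\<mu>\<^sub>I)"
    using w(2,3) \<phi> \<psi> by (simp add: distrib_right integrable_mult_test_fun)
qed

lemma weak_deriv_mult:
  assumes v: "weak_deriv v v'" "continuous_on {0..1/2} v" "integrable \<mu>\<^sub>I v'"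
    and w: "weak_deriv w w'" "continuous_on {0..1/2} w" "integrable \<mu>\<^sub>I w'"
  shows "weak_deriv (\<lambda>x. v x * w x) (\<lambda>x. v' x * w x + v x * w' x)"
  unfolding weak_deriv_iff
proof (intro allI impI)
  fix \<phi> assume \<phi>: "test_fun \<phi>"
  note \<phi>' = test_fun_deriv[OF \<phi>]
  have v_int: "integrable \<mu>\<^sub>I v" and w_int: "integrable \<mu>\<^sub>I w"
    using v(2) w(2) by (auto intro: integrable_continuous_Ival)
  have int: "integrable \<mu>\<^sub>I (\<lambda>x. v' x * w x)" "integrable \<mu>\<^sub>I (\<lambda>x. v x * w' x)"
      "integrable \<mu>\<^sub>I (\<lambda>x. v x * w x)"
    using integrable_continuous_mult_Ival[OF w(2) v(3)] integrable_continuous_mult_Ival[OF v(2) w(3)]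
      integrable_continuous_mult_Ival[OF v(2) w_int] by (simp_all add: mult.commute)
  have "(\<integral>x. v x * (w' x * \<phi> x + w x * deriv \<phi> x) \<partial>\<mu>\<^sub>I) = - (\<integral>x. v' x * (w x * \<phi> x) \<partial>\<mu>\<^sub>I)"
  proof (rule weak_deriv_by_parts[OF v(1) v_int v(3)
        weak_deriv_mult_test_fun[OF w(1) w_int w(3) \<phi>]])
    show "continuous_on {0..1/2} (\<lambda>x. w x * \<phi> x)"
      by (intro continuous_intros w(2) test_fun_continuous_on \<phi>)
    show "integrable \<mu>\<^sub>I (\<lambda>x. w' x * \<phi> x + w x * deriv \<phi> x)"
      by (intro Bochner_Integration.integrable_add integrable_mult_test_fun w(3) w_int \<phi> \<phi>')
  qed (simp_all add: test_fun_boundary[OF \<phi>])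
  then show "(\<integral>x. v x * w x * deriv \<phi> x \<partial>\<mu>\<^sub>I) = - (\<integral>x. (v' x * w x + v x * w' x) * \<phi> x \<partial>\<mu>\<^sub>I)"
    using int[THEN integrable_mult_test_fun] \<phi> \<phi>'
    by (simp add: distrib_left distrib_right flip: mult.assoc)
qed

section \<open>Energy balance\<close>

lemma momentum_energy_identity:
  assumes u: "weak_deriv u ux" "continuous_on {0..1/2} u" "u 0 = 0" "u (1/2) = 0"
    and L2: "square_integrable \<mu>\<^sub>I ux" "square_integrable \<mu>\<^sub>I uxx" "square_integrable \<mu>\<^sub>I utx"
    and ut: "weak_deriv ut utx" and \<rho>: "continuous_on {0..1/2} \<rho>"
    and momentum: "\<And>\<phi>. test_fun \<phi> \<Longrightarrow> - (\<integral>x. ut x * deriv (deriv \<phi>) x \<partial>\<mu>\<^sub>I)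
      = - (\<integral>x. u x * uxx x * deriv \<phi> x \<partial>\<mu>\<^sub>I) + (\<integral>x. ux x * uxx x * \<phi> x \<partial>\<mu>\<^sub>I)
        + \<kappa> / 2 * (\<integral>x. (\<rho> x)^2 * deriv \<phi> x \<partial>\<mu>\<^sub>I)"
  shows "(\<integral>x. utx x * ux x \<partial>\<mu>\<^sub>I) = \<kappa> / 2 * (\<integral>x. (\<rho> x)^2 * ux x \<partial>\<mu>\<^sub>I)"
proof -
  let ?F = "\<lambda>x. utx x + u x * uxx x - \<kappa> / 2 * (\<rho> x)^2"
  have F: "square_integrable \<mu>\<^sub>I (\<lambda>x. u x * uxx x)" "square_integrable \<mu>\<^sub>I (\<lambda>x. (\<rho> x)^2)"
    by (intro square_integrable_continuous_mult_Ival square_integrable_continuous_Ival continuous_intros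
        u(2) \<rho> L2(2))+
  have int: "integrable \<mu>\<^sub>I (\<lambda>x. utx x * v x)" "integrable \<mu>\<^sub>I (\<lambda>x. u x * uxx x * v x)"
      "integrable \<mu>\<^sub>I (\<lambda>x. (\<rho> x)^2 * v x)" if "square_integrable \<mu>\<^sub>I v" for v
    using F L2 that by (auto intro: square_integrable_integrable_mult)
  have "weak_deriv ?F (\<lambda>x. - (ux x * uxx x))"
    unfolding weak_deriv_iff
  proof (intro allI impI)
    fix \<phi> assume \<phi>: "test_fun \<phi>"
    have "(\<integral>x. utx x * deriv \<phi> x \<partial>\<mu>\<^sub>I) + (\<integral>x. u x * uxx x * deriv \<phi> x \<partial>\<mu>\<^sub>I)
        - \<kappa> / 2 * (\<integral>x. (\<rho> x)^2 * deriv \<phi> x \<partial>\<mu>\<^sub>I) = (\<integral>x. ux x * uxx x * \<phi> x \<partial>\<mu>\<^sub>I)"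
      using momentum[OF \<phi>] weak_derivD[OF ut test_fun_deriv[OF \<phi>]] by simp
    then show "(\<integral>x. ?F x * deriv \<phi> x \<partial>\<mu>\<^sub>I) = - (\<integral>x. - (ux x * uxx x) * \<phi> x \<partial>\<mu>\<^sub>I)"
      using int[OF test_fun_square_integrable[OF test_fun_deriv[OF \<phi>]]]
      by (simp add: distrib_right left_diff_distrib mult.assoc)
  qed
  moreover have "integrable \<mu>\<^sub>I ?F"
    using F L2 by (intro Ival.square_integrable_integrable square_integrable_add
        square_integrable_diff square_integrable_cmult)
  moreover have "integrable \<mu>\<^sub>I (\<lambda>x. - (ux x * uxx x))"
    using L2 by (simp add: square_integrable_integrable_mult)
  ultimately have "(\<integral>x. ?F x * ux x \<partial>\<mu>\<^sub>I) = - (\<integral>x. - (ux x * uxx x) * u x \<partial>\<mu>\<^sub>I)"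
    using u L2(1) by (intro weak_deriv_by_parts) (auto intro: Ival.square_integrable_integrable)
  moreover have "(\<integral>x. ?F x * ux x \<partial>\<mu>\<^sub>I) = (\<integral>x. utx x * ux x \<partial>\<mu>\<^sub>I)
      + (\<integral>x. u x * uxx x * ux x \<partial>\<mu>\<^sub>I) - \<kappa> / 2 * (\<integral>x. (\<rho> x)^2 * ux x \<partial>\<mu>\<^sub>I)"
    using int[OF L2(1)] by (simp add: distrib_right left_diff_distrib mult.assoc)
  ultimately show ?thesis
    by (simp add: mult_ac)
qed

lemma continuity_energy_identity:
  assumes u: "weak_deriv u ux" "continuous_on {0..1/2} u" "square_integrable \<mu>\<^sub>I ux"
    and \<rho>: "weak_deriv \<rho> \<rho>x" "continuous_on {0..1/2} \<rho>" "\<rho> 0 = 0" "\<rho> (1/2) = 0"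
      "square_integrable \<mu>\<^sub>I \<rho>x"
    and rt: "square_integrable \<mu>\<^sub>I rt"
    and continuity: "\<And>\<phi>. test_fun \<phi> \<Longrightarrow> (\<integral>x. rt x * \<phi> x \<partial>\<mu>\<^sub>I) = (\<integral>x. \<rho> x * u x * deriv \<phi> x \<partial>\<mu>\<^sub>I)"
  shows "(\<integral>x. \<rho> x * rt x \<partial>\<mu>\<^sub>I) = - 1 / 2 * (\<integral>x. (\<rho> x)^2 * ux x \<partial>\<mu>\<^sub>I)"
proof -
  have cont: "continuous_on {0..1/2} (\<lambda>x. \<rho> x * u x)" "continuous_on {0..1/2} (\<lambda>x. \<rho> x * \<rho> x)"
    using u(2) \<rho>(2) by (auto intro: continuous_intros)
  have int: "integrable \<mu>\<^sub>I u" "integrable \<mu>\<^sub>I ux" "integrable \<mu>\<^sub>I \<rho>x" "integrable \<mu>\<^sub>I rt"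
      "integrable \<mu>\<^sub>I (\<lambda>x. \<rho> x * u x)" "integrable \<mu>\<^sub>I (\<lambda>x. \<rho> x * \<rho>x x)"
    using u \<rho> rt cont
    by (auto intro: Ival.square_integrable_integrable integrable_continuous_Ival
        square_integrable_continuous_mult_Ival)
  have "weak_deriv (\<lambda>x. \<rho> x * u x) (\<lambda>x. - rt x)"
    using continuity by (simp add: weak_deriv_iff)
  then have "(\<integral>x. \<rho> x * u x * \<rho>x x \<partial>\<mu>\<^sub>I) = - (\<integral>x. - rt x * \<rho> x \<partial>\<mu>\<^sub>I)"
    using \<rho> int by (intro weak_deriv_by_parts) auto
  moreover have "(\<integral>x. u x * (\<rho>x x * \<rho> x + \<rho> x * \<rho>x x) \<partial>\<mu>\<^sub>I) = - (\<integral>x. ux x * (\<rho> x * \<rho> x) \<partial>\<mu>\<^sub>I)"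
    using u \<rho> int cont by (intro weak_deriv_by_parts weak_deriv_mult) (auto simp: mult.commute)
  moreover have "(\<integral>x. u x * (\<rho>x x * \<rho> x + \<rho> x * \<rho>x x) \<partial>\<mu>\<^sub>I) = 2 * (\<integral>x. \<rho> x * u x * \<rho>x x \<partial>\<mu>\<^sub>I)"
    unfolding integral_mult_right_zero[symmetric]
    by (rule Bochner_Integration.integral_cong) simp_all
  ultimately show ?thesis
    by (simp add: power2_eq_square mult_ac)
qed

lemma pde_at_energy_balance:
  assumes pde: "pde_at \<kappa> u \<rho> ut rt"
    and u: "weak_deriv u ux" "continuous_on {0..1/2} u" "u 0 = 0" "u (1/2) = 0"
      "square_integrable \<mu>\<^sub>I ux"
    and \<rho>: "weak_deriv \<rho> \<rho>x" "continuous_on {0..1/2} \<rho>" "\<rho> 0 = 0" "\<rho> (1/2) = 0"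
      "square_integrable \<mu>\<^sub>I \<rho>x"
    and ut: "weak_deriv ut utx" "square_integrable \<mu>\<^sub>I utx" and rt: "square_integrable \<mu>\<^sub>I rt"
  shows "(\<integral>x. ux x * utx x \<partial>\<mu>\<^sub>I) + \<kappa> * (\<integral>x. \<rho> x * rt x \<partial>\<mu>\<^sub>I) = 0"
proof -
  from pde obtain vx vxx where
      v: "square_integrable \<mu>\<^sub>I vx" "square_integrable \<mu>\<^sub>I vxx" "weak_deriv u vx"
    and momentum: "\<And>\<phi>. test_fun \<phi> \<Longrightarrow> - (\<integral>x. ut x * deriv (deriv \<phi>) x \<partial>\<mu>\<^sub>I)
      = - (\<integral>x. u x * vxx x * deriv \<phi> x \<partial>\<mu>\<^sub>I) + (\<integral>x. vx x * vxx x * \<phi> x \<partial>\<mu>\<^sub>I)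
        + \<kappa> / 2 * (\<integral>x. (\<rho> x)^2 * deriv \<phi> x \<partial>\<mu>\<^sub>I)"
    and continuity: "\<And>\<phi>. test_fun \<phi> \<Longrightarrow> (\<integral>x. rt x * \<phi> x \<partial>\<mu>\<^sub>I) = (\<integral>x. \<rho> x * u x * deriv \<phi> x \<partial>\<mu>\<^sub>I)"
    unfolding pde_at_def L2_mem_iff set_lebesgue_integral_Ival by blast
  have "AE x in \<mu>\<^sub>I. ux x = vx x"
    using u(1,5) v(1,3) by (intro weak_deriv_unique Ival.square_integrable_integrable)
  then have "(\<integral>x. ux x * utx x \<partial>\<mu>\<^sub>I) = (\<integral>x. utx x * vx x \<partial>\<mu>\<^sub>I)"
    using u(5) v(1) ut(2)
    by (intro integral_cong_AE borel_measurable_integrable square_integrable_integrable_mult)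
      (auto elim!: eventually_mono)
  moreover have "(\<integral>x. utx x * vx x \<partial>\<mu>\<^sub>I) = \<kappa> / 2 * (\<integral>x. (\<rho> x)^2 * vx x \<partial>\<mu>\<^sub>I)"
    by (rule momentum_energy_identity[OF v(3) u(2-4) v(1,2) ut(2,1) \<rho>(2) momentum])
  moreover have "(\<integral>x. \<rho> x * rt x \<partial>\<mu>\<^sub>I) = - 1 / 2 * (\<integral>x. (\<rho> x)^2 * vx x \<partial>\<mu>\<^sub>I)"
    by (rule continuity_energy_identity[OF v(3) u(2) v(1) \<rho> rt continuity])
  ultimately show ?thesis
    by simp
qed

section \<open>Sobolev spaces of fractional order\<close>

definition gag_kernel :: "real \<Rightarrow> (real \<Rightarrow> real) \<Rightarrow> real \<Rightarrow> real \<Rightarrow> ennreal" where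
  "gag_kernel \<sigma> f x y = ennreal (\<bar>f x - f y\<bar>^2 / \<bar>x - y\<bar> powr (1 + 2*\<sigma>))"

lemma gag_sq_eq_iterated:
  assumes f: "f \<in> borel_measurable \<mu>\<^sub>I"
  shows "gag_sq \<sigma> f = (\<integral>\<^sup>+x. \<integral>\<^sup>+y. gag_kernel \<sigma> f x y \<partial>\<mu>\<^sub>I \<partial>\<mu>\<^sub>I)"
proof -
  define F where "F x = indicator Ival x *\<^sub>R f x" for x
  have [measurable]: "F \<in> borel_measurable borel"
    using f by (simp add: F_def[abs_def] borel_measurable_restrict_space_iff)
  have "gag_sq \<sigma> f = (\<integral>\<^sup>+p. indicator Ival (fst p) *
      (indicator Ival (snd p) * gag_kernel \<sigma> F (fst p) (snd p)) \<partial>(lborel \<Otimes>\<^sub>M lborel))"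
    unfolding gag_sq_def by (rule nn_integral_cong) (auto simp: gag_kernel_def F_def indicator_def)
  also have "\<dots> = (\<integral>\<^sup>+x. \<integral>\<^sup>+y. indicator Ival x * (indicator Ival y * gag_kernel \<sigma> F x y)
      \<partial>lborel \<partial>lborel)"
    unfolding gag_kernel_def by (subst lborel.nn_integral_fst[symmetric]) auto
  also have "\<dots> = (\<integral>\<^sup>+x. indicator Ival x *
      (\<integral>\<^sup>+y. indicator Ival y * gag_kernel \<sigma> F x y \<partial>lborel) \<partial>lborel)"
    unfolding gag_kernel_def by (intro nn_integral_cong) (simp add: nn_integral_cmult)
  also have "\<dots> = (\<integral>\<^sup>+x. \<integral>\<^sup>+y. gag_kernel \<sigma> F x y \<partial>\<mu>\<^sub>I \<partial>\<mu>\<^sub>I)"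
    by (simp add: nn_integral_restrict_space mult.commute)
  also have "\<dots> = (\<integral>\<^sup>+x. \<integral>\<^sup>+y. gag_kernel \<sigma> f x y \<partial>\<mu>\<^sub>I \<partial>\<mu>\<^sub>I)"
    by (intro nn_integral_cong) (simp add: gag_kernel_def F_def)
  finally show ?thesis .
qed

lemma gag_kernel_add_le:
  "gag_kernel \<sigma> (\<lambda>x. f x + g x) x y \<le> 2 * gag_kernel \<sigma> f x y + 2 * gag_kernel \<sigma> g x y"
proof -
  define w where "w = \<bar>x - y\<bar> powr (1 + 2*\<sigma>)"
  define c d where "c = f x - f y" and "d = g x - g y"
  have w: "0 \<le> w"
    by (simp add: w_def)
  have "(c + d)^2 \<le> 2 * c^2 + 2 * d^2"
    using sum_squares_bound[of c d] by (simp add: power2_sum)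
  then have "(c + d)^2 / w \<le> (2 * c^2 + 2 * d^2) / w"
    using w by (rule divide_right_mono)
  then have "ennreal ((c + d)^2 / w) \<le> ennreal (2 * (c^2 / w) + 2 * (d^2 / w))"
    by (intro ennreal_leI) (simp add: add_divide_distrib)
  also have "\<dots> = 2 * ennreal (c^2 / w) + 2 * ennreal (d^2 / w)"
    using w
    by (simp only: ennreal_numeral[symmetric] ennreal_mult[symmetric] ennreal_plus[symmetric]
        mult_nonneg_nonneg divide_nonneg_nonneg zero_le_power2 zero_le_numeral)
  finally show ?thesis
    by (simp add: gag_kernel_def c_def d_def w_def add_diff_add)
qed

lemma gag_sq_add_finite:
  assumes f: "f \<in> borel_measurable \<mu>\<^sub>I" "gag_sq \<sigma> f < \<infinity>"
    and g: "g \<in> borel_measurable \<mu>\<^sub>I" "gag_sq \<sigma> g < \<infinity>"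
  shows "gag_sq \<sigma> (\<lambda>x. f x + g x) < \<infinity>"
proof -
  note [measurable] = f(1) g(1)
  have "gag_sq \<sigma> (\<lambda>x. f x + g x)
      \<le> (\<integral>\<^sup>+x. \<integral>\<^sup>+y. 2 * gag_kernel \<sigma> f x y + 2 * gag_kernel \<sigma> g x y \<partial>\<mu>\<^sub>I \<partial>\<mu>\<^sub>I)"
    by (subst gag_sq_eq_iterated) (auto intro!: nn_integral_mono gag_kernel_add_le)
  also have "\<dots> = 2 * gag_sq \<sigma> f + 2 * gag_sq \<sigma> g"
    unfolding gag_sq_eq_iterated[OF f(1)] gag_sq_eq_iterated[OF g(1)] gag_kernel_def
    by (simp add: nn_integral_add nn_integral_cmult)
  also have "\<dots> < \<infinity>"
    using f(2) g(2) by (simp add: ennreal_mult_less_top)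
  finally show ?thesis .
qed

lemma gag_sq_cmult_finite:
  assumes f: "f \<in> borel_measurable \<mu>\<^sub>I" "gag_sq \<sigma> f < \<infinity>"
  shows "gag_sq \<sigma> (\<lambda>x. c * f x) < \<infinity>"
proof -
  note [measurable] = f(1)
  have "gag_kernel \<sigma> (\<lambda>x. c * f x) x y = ennreal (c^2) * gag_kernel \<sigma> f x y" for x y
    by (simp add: gag_kernel_def abs_mult power_mult_distrib flip: ennreal_mult right_diff_distrib)
  then have "gag_sq \<sigma> (\<lambda>x. c * f x) = ennreal (c^2) * gag_sq \<sigma> f"
    by (simp add: gag_sq_eq_iterated f(1)) (simp add: gag_kernel_def nn_integral_cmult)
  then show ?thesis
    using f(2) by (simp add: ennreal_mult_less_top)
qed

lemma nn_integral_abs_powr_finite: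
  fixes a r :: real
  assumes "a > -1" "0 \<le> r"
  shows "(\<integral>\<^sup>+z. indicator {-r..r} z * ennreal (\<bar>z\<bar> powr a) \<partial>lborel) < \<infinity>"
proof -
  let ?h = "\<lambda>z::real. indicator {0..r} z * ennreal (\<bar>z\<bar> powr a)"
  have "(\<lambda>x. \<bar>x\<bar> powr a) integrable_on {0..r}"
    using integrable_on_powr_from_0[OF assms] by (rule integrable_eq) auto
  then obtain I where "((\<lambda>x. \<bar>x\<bar> powr a) has_integral I) {0..r}" by blast
  from nn_integral_has_integral_lebesgue'[OF _ this]
  have I: "(\<integral>\<^sup>+z. ?h z \<partial>lborel) = ennreal I" by (simp add: mult.commute)
  have "(\<integral>\<^sup>+z. indicator {-r..r} z * ennreal (\<bar>z\<bar> powr a) \<partial>lborel)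
      \<le> (\<integral>\<^sup>+z. ?h z + ?h (0 + - 1 * z) \<partial>lborel)"
    by (intro nn_integral_mono) (auto simp: indicator_def)
  also have "\<dots> = (\<integral>\<^sup>+z. ?h z \<partial>lborel) + (\<integral>\<^sup>+z. ?h (0 + - 1 * z) \<partial>lborel)"
    by (intro nn_integral_add) auto
  also have "(\<integral>\<^sup>+z. ?h (0 + - 1 * z) \<partial>lborel) = (\<integral>\<^sup>+z. ?h z \<partial>lborel)"
    by (subst (2) nn_integral_real_affine[where c = "-1" and t = 0]) auto
  finally show ?thesis by (rule le_less_trans) (simp add: I)
qed

lemma nn_integral_Ival_dist_powr_le:
  assumes "x \<in> Ival"
  shows "(\<integral>\<^sup>+y. ennreal (\<bar>x - y\<bar> powr a) \<partial>\<mu>\<^sub>I)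
    \<le> (\<integral>\<^sup>+z. indicator {-1/2..1/2} z * ennreal (\<bar>z\<bar> powr a) \<partial>lborel)"
proof -
  have "(\<integral>\<^sup>+y. ennreal (\<bar>x - y\<bar> powr a) \<partial>\<mu>\<^sub>I)
      \<le> (\<integral>\<^sup>+y. indicator {-1/2..1/2} (x + - 1 * y) * ennreal (\<bar>x + - 1 * y\<bar> powr a) \<partial>lborel)"
    using assms by (simp add: nn_integral_restrict_space)
      (auto intro!: nn_integral_mono simp: indicator_def Ival_def)
  also have "\<dots> = (\<integral>\<^sup>+z. indicator {-1/2..1/2} z * ennreal (\<bar>z\<bar> powr a) \<partial>lborel)"
    by (subst (2) nn_integral_real_affine[where c = "-1" and t = x]) auto
  finally show ?thesis .
qed

lemma gag_kernel_le_if_Hoelder: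
  assumes "(f x - f y)^2 \<le> \<bar>x - y\<bar> * c" "0 \<le> c"
  shows "gag_kernel \<sigma> f x y \<le> ennreal c * ennreal (\<bar>x - y\<bar> powr (- 2 * \<sigma>))"
proof -
  have "(f x - f y)^2 / \<bar>x - y\<bar> powr (1 + 2 * \<sigma>) \<le> \<bar>x - y\<bar> * c / \<bar>x - y\<bar> powr (1 + 2 * \<sigma>)"
    using assms(1) by (rule divide_right_mono) simp
  also have "\<dots> = c * \<bar>x - y\<bar> powr (- 2 * \<sigma>)"
    by (cases "x = y") (auto simp: powr_add powr_minus field_simps)
  finally show ?thesis
    using assms(2) by (simp add: gag_kernel_def ennreal_leI flip: ennreal_mult)
qed

lemma nn_integral_gag_kernel_le_if_Hoelder:
  assumes x: "x \<in> Ival" and Hoelder: "AE y in \<mu>\<^sub>I. (f x - f y)^2 \<le> \<bar>x - y\<bar> * c" and c: "0 \<le> c"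
  shows "(\<integral>\<^sup>+y. gag_kernel \<sigma> f x y \<partial>\<mu>\<^sub>I)
    \<le> ennreal c * (\<integral>\<^sup>+z. indicator {-1/2..1/2} z * ennreal (\<bar>z\<bar> powr (- 2 * \<sigma>)) \<partial>lborel)"
proof -
  have "AE y in \<mu>\<^sub>I. gag_kernel \<sigma> f x y \<le> ennreal c * ennreal (\<bar>x - y\<bar> powr (- 2 * \<sigma>))"
    using Hoelder by eventually_elim (rule gag_kernel_le_if_Hoelder[OF _ c])
  then have "(\<integral>\<^sup>+y. gag_kernel \<sigma> f x y \<partial>\<mu>\<^sub>I) \<le> (\<integral>\<^sup>+y. ennreal c * ennreal (\<bar>x - y\<bar> powr (- 2 * \<sigma>)) \<partial>\<mu>\<^sub>I)"
    by (rule nn_integral_mono_AE)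
  also have "\<dots> = ennreal c * (\<integral>\<^sup>+y. ennreal (\<bar>x - y\<bar> powr (- 2 * \<sigma>)) \<partial>\<mu>\<^sub>I)"
    by (rule nn_integral_cmult) measurable
  also have "\<dots> \<le> ennreal c * (\<integral>\<^sup>+z. indicator {-1/2..1/2} z * ennreal (\<bar>z\<bar> powr (- 2 * \<sigma>)) \<partial>lborel)"
    by (intro mult_left_mono nn_integral_Ival_dist_powr_le x) auto
  finally show ?thesis .
qed

text \<open>Up to a null set \<open>f\<close> is Hoelder continuous with exponent \<open>1/2\<close>, which bounds the kernel by a
  multiple of \<open>\<bar>x - y\<bar> powr (- 2 * \<sigma>)\<close>; this is integrable only for \<open>\<sigma> < 1/2\<close>.\<close>

lemma gag_sq_finite_if_weak_deriv:
  assumes "weak_deriv f g" "square_integrable \<mu>\<^sub>I f" "square_integrable \<mu>\<^sub>I g" "\<sigma> < 1/2"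
  shows "gag_sq \<sigma> f < \<infinity>"
proof -
  obtain k where k: "AE x in \<mu>\<^sub>I. f x = k + primitive \<mu>\<^sub>I g x"
    using weak_deriv_imp_AE_primitive[OF assms(1)
        assms(2,3)[THEN Ival.square_integrable_integrable]] .
  define c where "c = (norm_L2 \<mu>\<^sub>I g)^2"
  define I where "I = (\<integral>\<^sup>+z. indicator {-1/2..1/2} z * ennreal (\<bar>z\<bar> powr (- 2 * \<sigma>)) \<partial>lborel)"
  have "gag_sq \<sigma> f = (\<integral>\<^sup>+x. \<integral>\<^sup>+y. gag_kernel \<sigma> f x y \<partial>\<mu>\<^sub>I \<partial>\<mu>\<^sub>I)"
    using assms(2) by (simp add: gag_sq_eq_iterated square_integrable_measurable)
  also have "\<dots> \<le> (\<integral>\<^sup>+x. ennreal c * I \<partial>\<mu>\<^sub>I)"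
  proof (rule nn_integral_mono_AE)
    show "AE x in \<mu>\<^sub>I. (\<integral>\<^sup>+y. gag_kernel \<sigma> f x y \<partial>\<mu>\<^sub>I) \<le> ennreal c * I"
      using k AE_space
    proof eventually_elim
      case (elim x)
      have "AE y in \<mu>\<^sub>I. (f x - f y)^2 \<le> \<bar>x - y\<bar> * c"
        using k
      proof eventually_elim
        case (elim y)
        then show ?case
          using \<open>f x = _\<close> primitive_Ival_diff_power2_le[OF assms(3), of x y] by (simp add: c_def)
      qed
      then show ?case
        unfolding I_def using elim(2)
        by (intro nn_integral_gag_kernel_le_if_Hoelder) (auto simp: c_def)
    qed
  qed
  also have "\<dots> = ennreal c * I * emeasure \<mu>\<^sub>I Ival"
    by (simp add: nn_integral_const)
  also have "\<dots> < \<infinity>"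
    using nn_integral_abs_powr_finite[of "- 2 * \<sigma>" "1/2"] assms(4)
    by (simp add: I_def ennreal_mult_less_top emeasure_space_Ival del: ennreal_half)
  finally show ?thesis .
qed

lemma sob_chainD:
  assumes "sob_chain r f g"
  shows "\<And>x. x \<in> Ival \<Longrightarrow> g 0 x = f x"
    and "\<And>j. j \<le> nat \<lfloor>r\<rfloor> \<Longrightarrow> square_integrable \<mu>\<^sub>I (g j)"
    and "\<And>j. j < nat \<lfloor>r\<rfloor> \<Longrightarrow> weak_deriv (g j) (g (Suc j))"
    and "frac r \<noteq> 0 \<Longrightarrow> gag_sq (frac r) (g (nat \<lfloor>r\<rfloor>)) < \<infinity>"
  using assms by (auto simp: sob_chain_def L2_mem_iff)

lemma sob_chainE:
  assumes "H_mem r f"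
  obtains g where "sob_chain r f g"
  using assms by (auto simp: H_mem_def)

lemma H_mem_add:
  assumes "H_mem r f" "H_mem r g"
  shows "H_mem r (\<lambda>x. f x + g x)"
proof -
  obtain F where F: "sob_chain r f F" using assms(1) by (rule sob_chainE)
  obtain G where G: "sob_chain r g G" using assms(2) by (rule sob_chainE)
  note F' = sob_chainD[OF F] and G' = sob_chainD[OF G]
  have "sob_chain r (\<lambda>x. f x + g x) (\<lambda>j x. F j x + G j x)"
    unfolding sob_chain_def L2_mem_iff
  proof (intro conjI ballI allI impI)
    show "weak_deriv (\<lambda>x. F j x + G j x) (\<lambda>x. F (Suc j) x + G (Suc j) x)" if "j < nat \<lfloor>r\<rfloor>" for j
      using that by (intro weak_deriv_add Ival.square_integrable_integrable F' G') auto
    show "gag_sq (frac r) (\<lambda>x. F (nat \<lfloor>r\<rfloor>) x + G (nat \<lfloor>r\<rfloor>) x) < \<infinity>" if "frac r \<noteq> 0"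
      using that by (intro gag_sq_add_finite square_integrable_measurable F' G') auto
  qed (auto intro!: square_integrable_add F' G' simp: F'(1) G'(1))
  then show ?thesis
    using assms by (auto simp: H_mem_def)
qed

lemma H_mem_cmult:
  assumes "H_mem r f"
  shows "H_mem r (\<lambda>x. c * f x)"
proof -
  obtain F where F: "sob_chain r f F" using assms by (rule sob_chainE)
  note F' = sob_chainD[OF F]
  have "sob_chain r (\<lambda>x. c * f x) (\<lambda>j x. c * F j x)"
    unfolding sob_chain_def L2_mem_iff
  proof (intro conjI ballI allI impI)
    show "gag_sq (frac r) (\<lambda>x. c * F (nat \<lfloor>r\<rfloor>) x) < \<infinity>" if "frac r \<noteq> 0"
      using that by (intro gag_sq_cmult_finite square_integrable_measurable F') auto
  qed (auto intro!: square_integrable_cmult weak_deriv_cmult F' simp: F'(1))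
  then show ?thesis
    using assms by (auto simp: H_mem_def)
qed

lemma H_mem_difference_quotient:
  assumes "H_mem r f" "H_mem r g" "H_mem r k"
  shows "H_mem r (\<lambda>x. (f x - g x) / h - k x)"
proof -
  have "H_mem r (\<lambda>x. (1 / h) * (f x + (- 1) * g x) + (- 1) * k x)"
    by (intro H_mem_add H_mem_cmult assms)
  then show ?thesis by simp
qed

lemma H_mem_pred:
  assumes "H_mem r f" "1 \<le> r" "frac r < 1/2"
  shows "H_mem (r - 1) f"
proof -
  obtain g where g: "sob_chain r f g" using assms(1) by (rule sob_chainE)
  note g' = sob_chainD[OF g]
  define n where "n = nat \<lfloor>r - 1\<rfloor>"
  have n: "nat \<lfloor>r\<rfloor> = Suc n"
    using assms(2) by (simp add: n_def) linarith
  have "gag_sq (frac r) (g n) < \<infinity>"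
    using n assms(3) by (intro gag_sq_finite_if_weak_deriv[of _ "g (Suc n)"] g') auto
  moreover have "frac (r - 1) = frac r"
    by (simp add: frac_def)
  ultimately have "sob_chain (r - 1) f g"
    using g' n unfolding sob_chain_def L2_mem_iff n_def[symmetric] by auto
  then show ?thesis
    using assms(2) by (auto simp: H_mem_def)
qed

lemma H_mem_square_integrable:
  assumes "H_mem r f"
  shows "square_integrable \<mu>\<^sub>I f"
proof -
  obtain g where g: "sob_chain r f g" using assms by (rule sob_chainE)
  have "square_integrable \<mu>\<^sub>I f \<longleftrightarrow> square_integrable \<mu>\<^sub>I (g 0)"
    unfolding square_integrable_def using sob_chainD(1)[OF g]
    by (intro arg_cong2[where f = conj] measurable_cong Bochner_Integration.integrable_cong) auto
  then show ?thesis
    using sob_chainD(2)[OF g] by simp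
qed

lemma sob_chain_SOME: "H_mem r f \<Longrightarrow> sob_chain r f (SOME g. sob_chain r f g)"
  using someI_ex[of "sob_chain r f"] by (simp add: H_mem_def)

lemma norm_L2_sob_chain_le:
  assumes "H_mem r f"
  obtains g where "sob_chain r f g" "\<And>j. j \<le> nat \<lfloor>r\<rfloor> \<Longrightarrow> norm_L2 \<mu>\<^sub>I (g j) \<le> H_norm r f"
proof -
  define g where "g = (SOME g. sob_chain r f g)"
  have g: "sob_chain r f g"
    unfolding g_def using assms by (rule sob_chain_SOME)
  have "norm_L2 \<mu>\<^sub>I (g j) \<le> H_norm r f" if "j \<le> nat \<lfloor>r\<rfloor>" for j
  proof -
    have "(L2_norm (g j))^2 \<le> (\<Sum>j\<le>nat \<lfloor>r\<rfloor>. (L2_norm (g j))^2)"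
      using that by (intro member_le_sum) auto
    also have "\<dots> \<le> (\<Sum>j\<le>nat \<lfloor>r\<rfloor>. (L2_norm (g j))^2) +
        (if frac r = 0 then 0 else enn2real (gag_sq (frac r) (g (nat \<lfloor>r\<rfloor>))))"
      by simp
    finally show ?thesis
      unfolding H_norm_def Let_def g_def[symmetric] L2_norm_eq by (rule real_le_rsqrt)
  qed
  with g show ?thesis by (rule that)
qed

lemma sob_chain_weak_deriv:
  assumes g: "sob_chain r f g" and r: "1 \<le> r"
  shows "weak_deriv f (g 1)" "square_integrable \<mu>\<^sub>I (g 1)"
proof -
  have "1 \<le> nat \<lfloor>r\<rfloor>"
    using r by linarith
  then show "square_integrable \<mu>\<^sub>I (g 1)" "weak_deriv f (g 1)"
    using sob_chainD(2)[OF g, of 1] sob_chainD(3)[OF g, of 0] r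
      weak_deriv_cong[of "g 0" f "g 1", OF sob_chainD(1)[OF g]]
    by auto
qed

lemma norm_L2_le_H_norm:
  assumes "H_mem r f"
  shows "norm_L2 \<mu>\<^sub>I f \<le> H_norm r f"
proof -
  obtain g where g: "sob_chain r f g" "\<And>j. j \<le> nat \<lfloor>r\<rfloor> \<Longrightarrow> norm_L2 \<mu>\<^sub>I (g j) \<le> H_norm r f"
    using norm_L2_sob_chain_le[OF assms] by blast
  have "norm_L2 \<mu>\<^sub>I f = norm_L2 \<mu>\<^sub>I (g 0)"
    using sob_chainD(1)[OF g(1)] by (intro norm_L2_cong) simp
  then show ?thesis
    using g(2)[of 0] by simp
qed

text \<open>Arbitrary if \<open>f\<close> has no square-integrable weak derivative.\<close>

definition wderiv :: "(real \<Rightarrow> real) \<Rightarrow> real \<Rightarrow> real" where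
  "wderiv f = (SOME g. square_integrable \<mu>\<^sub>I g \<and> weak_deriv f g)"

lemma H_mem_wderiv:
  assumes "H_mem r f" "1 \<le> r"
  shows "square_integrable \<mu>\<^sub>I (wderiv f)" "weak_deriv f (wderiv f)"
proof -
  obtain g where g: "sob_chain r f g" using assms(1) by (rule sob_chainE)
  have "\<exists>g. square_integrable \<mu>\<^sub>I g \<and> weak_deriv f g"
    using sob_chain_weak_deriv[OF g assms(2)] by blast
  then have "square_integrable \<mu>\<^sub>I (wderiv f) \<and> weak_deriv f (wderiv f)"
    unfolding wderiv_def by (rule someI_ex)
  then show "square_integrable \<mu>\<^sub>I (wderiv f)" "weak_deriv f (wderiv f)"
    by simp_all
qed

lemma norm_L2_weak_deriv_unique:
  assumes "weak_deriv f g" "square_integrable \<mu>\<^sub>I g" "weak_deriv f h" "square_integrable \<mu>\<^sub>I h"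
  shows "norm_L2 \<mu>\<^sub>I g = norm_L2 \<mu>\<^sub>I h"
  using assms by (intro norm_L2_cong_AE weak_deriv_unique square_integrable_measurable
      Ival.square_integrable_integrable)

lemma norm_L2_weak_deriv_le_H_norm:
  assumes "H_mem r f" "1 \<le> r" "weak_deriv f h" "square_integrable \<mu>\<^sub>I h"
  shows "norm_L2 \<mu>\<^sub>I h \<le> H_norm r f"
proof -
  obtain g where g: "sob_chain r f g" "\<And>j. j \<le> nat \<lfloor>r\<rfloor> \<Longrightarrow> norm_L2 \<mu>\<^sub>I (g j) \<le> H_norm r f"
    using norm_L2_sob_chain_le[OF assms(1)] by blast
  have "norm_L2 \<mu>\<^sub>I h = norm_L2 \<mu>\<^sub>I (g 1)"
    by (rule norm_L2_weak_deriv_unique[OF assms(3,4) sob_chain_weak_deriv[OF g(1) assms(2)]])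
  also have "\<dots> \<le> H_norm r f"
    using assms(2) by (intro g(2)) linarith
  finally show ?thesis .
qed

lemma H_mem_1:
  assumes "H_mem r f" "1 \<le> r"
  shows "H_mem 1 f"
proof -
  have "sob_chain 1 f (\<lambda>j. if j = 0 then f else wderiv f)"
    using H_mem_wderiv[OF assms] H_mem_square_integrable[OF assms(1)]
    by (auto simp: sob_chain_def L2_mem_iff)
  then show ?thesis
    by (auto simp: H_mem_def)
qed

lemma H_norm_1_le:
  assumes f: "H_mem 1 f"
  shows "H_norm 1 f \<le> norm_L2 \<mu>\<^sub>I f + norm_L2 \<mu>\<^sub>I (wderiv f)"
proof -
  define g where "g = (SOME g. sob_chain 1 f g)"
  have g: "sob_chain 1 f g"
    unfolding g_def using f by (rule sob_chain_SOME)
  have "norm_L2 \<mu>\<^sub>I (g 0) = norm_L2 \<mu>\<^sub>I f"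
    using sob_chainD(1)[OF g] by (intro norm_L2_cong) simp
  moreover have "norm_L2 \<mu>\<^sub>I (g 1) = norm_L2 \<mu>\<^sub>I (wderiv f)"
    using sob_chain_weak_deriv[OF g] H_mem_wderiv[OF f] by (intro norm_L2_weak_deriv_unique) auto
  ultimately have "H_norm 1 f = sqrt ((norm_L2 \<mu>\<^sub>I f)^2 + (norm_L2 \<mu>\<^sub>I (wderiv f))^2)"
    unfolding H_norm_def Let_def g_def[symmetric] by (simp add: atMost_Suc L2_norm_eq)
  also have "\<dots> \<le> norm_L2 \<mu>\<^sub>I f + norm_L2 \<mu>\<^sub>I (wderiv f)"
    by (rule sqrt_sum_squares_le_sum) auto
  finally show ?thesis .
qed

section \<open>Conservation of energy\<close>

definition energy :: "real \<Rightarrow> (real \<Rightarrow> real) \<Rightarrow> (real \<Rightarrow> real) \<Rightarrow> real" where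
  "energy \<kappa> u \<rho> = (norm_L2 \<mu>\<^sub>I (wderiv u))^2 + \<kappa> * (norm_L2 \<mu>\<^sub>I \<rho>)^2"

lemma has_real_derivative_norm_L2_power2_if_H_norm:
  assumes a: "\<And>\<tau>. \<tau> \<in> S \<Longrightarrow> H_mem r (a \<tau>)" and b: "H_mem r b" and t: "t \<in> S"
    and lim: "((\<lambda>\<tau>. H_norm r (\<lambda>x. (a \<tau> x - a t x) / (\<tau> - t) - b x)) \<longlongrightarrow> 0) (at t within S)"
  shows "((\<lambda>\<tau>. (norm_L2 \<mu>\<^sub>I (a \<tau>))^2) has_real_derivative 2 * (\<integral>x. a t x * b x \<partial>\<mu>\<^sub>I)) (at t within S)"
proof (rule has_real_derivative_norm_L2_power2)
  have "\<forall>\<^sub>F \<tau> in at t within S. \<tau> \<in> S"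
    by (simp add: eventually_at_filter)
  then show "((\<lambda>\<tau>. norm_L2 \<mu>\<^sub>I (\<lambda>x. (a \<tau> x - a t x) / (\<tau> - t) - b x)) \<longlongrightarrow> 0) (at t within S)"
    using a b t by (intro tendsto_sandwich[OF _ _ tendsto_const lim])
      (auto elim!: eventually_mono intro!: norm_L2_le_H_norm H_mem_difference_quotient)
qed (use a b t in \<open>auto intro: H_mem_square_integrable\<close>)

lemma has_real_derivative_norm_L2_wderiv_power2_if_H_norm:
  assumes r: "1 \<le> r" and a: "\<And>\<tau>. \<tau> \<in> S \<Longrightarrow> H_mem r (a \<tau>)" and b: "H_mem r b" and t: "t \<in> S"
    and lim: "((\<lambda>\<tau>. H_norm r (\<lambda>x. (a \<tau> x - a t x) / (\<tau> - t) - b x)) \<longlongrightarrow> 0) (at t within S)"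
  shows "((\<lambda>\<tau>. (norm_L2 \<mu>\<^sub>I (wderiv (a \<tau>)))^2) has_real_derivative
    2 * (\<integral>x. wderiv (a t) x * wderiv b x \<partial>\<mu>\<^sub>I)) (at t within S)"
proof (rule has_real_derivative_norm_L2_power2)
  note a' = H_mem_wderiv[OF a r] and b' = H_mem_wderiv[OF b r]
  let ?q = "\<lambda>\<tau> x. (wderiv (a \<tau>) x - wderiv (a t) x) / (\<tau> - t) - wderiv b x"
  have "norm_L2 \<mu>\<^sub>I (?q \<tau>) \<le> H_norm r (\<lambda>x. (a \<tau> x - a t x) / (\<tau> - t) - b x)" if \<tau>: "\<tau> \<in> S" for \<tau>
  proof (rule norm_L2_weak_deriv_le_H_norm[OF H_mem_difference_quotient r])
    show "weak_deriv (\<lambda>x. (a \<tau> x - a t x) / (\<tau> - t) - b x) (?q \<tau>)"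
      using a[THEN H_mem_square_integrable] b[THEN H_mem_square_integrable] a' b' t \<tau>
      by (intro weak_deriv_difference_quotient) (auto intro: Ival.square_integrable_integrable)
    show "square_integrable \<mu>\<^sub>I (?q \<tau>)"
      using a' b' t \<tau> by (intro square_integrable_difference_quotient)
  qed (use a b t \<tau> in auto)
  moreover have "\<forall>\<^sub>F \<tau> in at t within S. \<tau> \<in> S"
    by (simp add: eventually_at_filter)
  ultimately show "((\<lambda>\<tau>. norm_L2 \<mu>\<^sub>I (?q \<tau>)) \<longlongrightarrow> 0) (at t within S)"
    by (intro tendsto_sandwich[OF _ _ tendsto_const lim]) (auto elim!: eventually_mono)
qed (use H_mem_wderiv[OF a r] H_mem_wderiv[OF b r] t in auto)

lemma is_sol_regularity:
  assumes "is_sol \<kappa> s u0 \<rho>0 T u \<rho>" "t \<in> tint T"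
  shows "continuous_on {0..1/2} (u t)" "u t 0 = 0" "u t (1/2) = 0" "H_mem s (u t)"
    and "continuous_on {0..1/2} (\<rho> t)" "\<rho> t 0 = 0" "\<rho> t (1/2) = 0" "H_mem (s - 1) (\<rho> t)"
  using assms by (simp_all add: is_sol_def)

text \<open>\<open>H_norm\<close> chooses a chain with \<open>SOME\<close>, so it controls nothing unless membership in the space is
  known. The solution class only gives membership one order higher than the norms in which the
  time derivatives are taken.\<close>

lemma is_sol_H_mem_pred:
  assumes "is_sol \<kappa> s u0 \<rho>0 T u \<rho>" "2 \<le> s" "s < 5/2" "t \<in> tint T"
  shows "H_mem (s - 1) (u t)" "H_mem (s - 2) (\<rho> t)"
proof -
  have "\<lfloor>s\<rfloor> = 2"
    using assms(2,3) by linarith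
  then have "frac s < 1/2" "frac (s - 1) < 1/2"
    using assms(3) by (auto simp: frac_def)
  then show "H_mem (s - 1) (u t)" "H_mem (s - 2) (\<rho> t)"
    using H_mem_pred[of s "u t"] H_mem_pred[of "s - 1" "\<rho> t"] assms(2)
      is_sol_regularity[OF assms(1,4)] by auto
qed

lemma is_sol_energy_has_derivative_0:
  assumes sol: "is_sol \<kappa> s u0 \<rho>0 T u \<rho>" and s: "2 \<le> s" "s < 5/2" and t: "t \<in> tint T"
  shows "((\<lambda>\<tau>. energy \<kappa> (u \<tau>) (\<rho> \<tau>)) has_real_derivative 0) (at t within tint T)"
proof -
  obtain ut rt where ut: "H_mem (s - 1) ut" and rt: "H_mem (s - 2) rt"
    and ut_lim: "((\<lambda>\<tau>. H_norm (s - 1) (\<lambda>x. (u \<tau> x - u t x) / (\<tau> - t) - ut x)) \<longlongrightarrow> 0)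
      (at t within tint T)"
    and rt_lim: "((\<lambda>\<tau>. H_norm (s - 2) (\<lambda>x. (\<rho> \<tau> x - \<rho> t x) / (\<tau> - t) - rt x)) \<longlongrightarrow> 0)
      (at t within tint T)"
    and pde: "pde_at \<kappa> (u t) (\<rho> t) ut rt"
    using sol t unfolding is_sol_def by blast
  note reg = is_sol_regularity[OF sol] and mem = is_sol_H_mem_pred[OF sol s]
  have orders: "1 \<le> s - 1" "1 \<le> s"
    using s by auto
  note ux = H_mem_wderiv[OF reg(4)[OF t] orders(2)]
    and \<rho>x = H_mem_wderiv[OF reg(8)[OF t] orders(1)]
    and utx = H_mem_wderiv[OF ut orders(1)]
  have "((\<lambda>\<tau>. energy \<kappa> (u \<tau>) (\<rho> \<tau>)) has_real_derivative
      2 * (\<integral>x. wderiv (u t) x * wderiv ut x \<partial>\<mu>\<^sub>I) + \<kappa> * (2 * (\<integral>x. \<rho> t x * rt x \<partial>\<mu>\<^sub>I)))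
      (at t within tint T)"
    unfolding energy_def
    by (intro DERIV_add DERIV_cmult
        has_real_derivative_norm_L2_wderiv_power2_if_H_norm[OF orders(1) mem(1) ut t ut_lim]
        has_real_derivative_norm_L2_power2_if_H_norm[OF mem(2) rt t rt_lim])
  also have "2 * (\<integral>x. wderiv (u t) x * wderiv ut x \<partial>\<mu>\<^sub>I) + \<kappa> * (2 * (\<integral>x. \<rho> t x * rt x \<partial>\<mu>\<^sub>I))
      = 2 * ((\<integral>x. wderiv (u t) x * wderiv ut x \<partial>\<mu>\<^sub>I) + \<kappa> * (\<integral>x. \<rho> t x * rt x \<partial>\<mu>\<^sub>I))"
    by simp
  also have "(\<integral>x. wderiv (u t) x * wderiv ut x \<partial>\<mu>\<^sub>I) + \<kappa> * (\<integral>x. \<rho> t x * rt x \<partial>\<mu>\<^sub>I) = 0"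
    by (rule pde_at_energy_balance[OF pde ux(2) reg(1-3)[OF t] ux(1) \<rho>x(2) reg(5-7)[OF t] \<rho>x(1)
          utx(2,1) H_mem_square_integrable[OF rt]])
  finally show ?thesis
    by simp
qed

lemma convex_tint: "convex (tint T)"
proof -
  have "is_interval (tint T)"
    unfolding is_interval_1 tint_def by auto (metis ereal_less_eq(3) le_less_trans)
  then show ?thesis by (rule is_interval_convex)
qed

lemma is_sol_energy_conserved:
  assumes "is_sol \<kappa> s u0 \<rho>0 T u \<rho>" "2 \<le> s" "s < 5/2" "t \<in> tint T"
  shows "energy \<kappa> (u t) (\<rho> t) = energy \<kappa> (u 0) (\<rho> 0)"
proof -
  have "0 \<in> tint T"
    using assms(4) le_less_trans[of "ereal 0" "ereal t" T] by (simp add: tint_def)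
  then show ?thesis
    using has_field_derivative_zero_constant[OF convex_tint
        is_sol_energy_has_derivative_0[OF assms(1-3)]] assms(4)
    by metis
qed

lemma norm_L2_le_norm_L2_wderiv:
  assumes "H_mem 1 f" "continuous_on {0..1/2} f" "f 0 = 0"
  shows "norm_L2 \<mu>\<^sub>I f \<le> norm_L2 \<mu>\<^sub>I (wderiv f)"
proof -
  note f' = H_mem_wderiv[OF assms(1) order_refl]
  have "\<bar>f x\<bar> \<le> norm_L2 \<mu>\<^sub>I (wderiv f)" if "x \<in> Ival" for x
    using that weak_deriv_FTC[OF f'(2) assms(2) Ival.square_integrable_integrable[OF f'(1)], of x]
      abs_primitive_Ival_le[OF f'(1), of x] assms(3) by (simp add: Ival_def)
  then have "norm_L2 \<mu>\<^sub>I f \<le> norm_L2 \<mu>\<^sub>I (wderiv f) * sqrt (measure \<mu>\<^sub>I Ival)"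
    using Ival.norm_L2_le_if_bounded[OF continuous_on_Ival_measurable[OF assms(2)]] by simp
  also have "\<dots> \<le> norm_L2 \<mu>\<^sub>I (wderiv f) * 1"
    by (intro mult_left_mono) (simp_all add: measure_space_Ival)
  finally show ?thesis by simp
qed

lemma H_norm_plus_L2_norm_le_energy:
  assumes "0 < \<kappa>" "H_mem 1 f" "continuous_on {0..1/2} f" "f 0 = 0"
  shows "H_norm 1 f + L2_norm \<rho> \<le> 2 * sqrt (energy \<kappa> f \<rho>) + sqrt (energy \<kappa> f \<rho> / \<kappa>)"
proof -
  have "norm_L2 \<mu>\<^sub>I (wderiv f) \<le> sqrt (energy \<kappa> f \<rho>)"
    using assms(1) by (intro real_le_rsqrt) (simp add: energy_def)
  moreover have "norm_L2 \<mu>\<^sub>I \<rho> \<le> sqrt (energy \<kappa> f \<rho> / \<kappa>)"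
    using assms(1) by (intro real_le_rsqrt) (simp add: energy_def field_simps)
  ultimately show ?thesis
    using H_norm_1_le[OF assms(2)] norm_L2_le_norm_L2_wderiv[OF assms(2-4)]
    by (simp add: L2_norm_eq)
qed

theorem theorem4p4:
  fixes \<kappa> s :: real and u0 \<rho>0 :: "real \<Rightarrow> real" and T :: ereal
    and u \<rho> :: "real \<Rightarrow> real \<Rightarrow> real"
  assumes "\<kappa> > 0" and "2 \<le> s" and "s < 5/2"
    and "H_mem s u0" and "H_mem (s - 1) \<rho>0"
    and "continuous_on {0..1/2} u0" and "continuous_on {0..1/2} \<rho>0"
    and "u0 0 = 0" and "u0 (1/2) = 0" and "\<rho>0 0 = 0" and "\<rho>0 (1/2) = 0"
    and "is_max_sol \<kappa> s u0 \<rho>0 T u \<rho>"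
  shows "\<forall>T'>0. \<exists>C. \<forall>t. 0 \<le> t \<and> ereal t < T \<and> t \<le> T' \<longrightarrow>
           H_norm 1 (u t) + L2_norm (\<rho> t) \<le> C"
proof -
  have sol: "is_sol \<kappa> s u0 \<rho>0 T u \<rho>"
    using assms(12) by (simp add: is_max_sol_def)
  let ?E = "energy \<kappa> (u 0) (\<rho> 0)"
  have "H_norm 1 (u t) + L2_norm (\<rho> t) \<le> 2 * sqrt ?E + sqrt (?E / \<kappa>)" if t: "t \<in> tint T" for t
  proof -
    note reg = is_sol_regularity[OF sol t]
    have "H_mem 1 (u t)"
      using H_mem_1[OF reg(4)] assms(2) by simp
    from H_norm_plus_L2_norm_le_energy[OF assms(1) this reg(1,2), of "\<rho> t"] show ?thesis
      by (simp add: is_sol_energy_conserved[OF sol assms(2,3) t])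
  qed
  then show ?thesis
    by (auto simp: tint_def)
qed

end
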